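(* Let $d\ge 1$ be an integer, let $\mu$ be a locally finite measure on $(0,+\infty)$ and let $s>0$ be a real number. Consider the two assertions: (A1) $\sup_{r>0} r^d\,\mu([r,+\infty))<\infty$; (A3) $\int_{[1,+\infty)}\beta^{d+s}\,\mu(d\beta)<\infty$. If $d\ge 2$, then there exists $\lambda_0>0$ such that $E_{\lambda,\mu}(M^s)$ is finite for all $\lambda\in(0,\lambda_0)$ if and only if both (A1) and (A3) hold. If $d=1$, then (A1) and (A3) together are sufficient for the existence of $\lambda_0>0$ such that $E_{\lambda,\mu}(M^s)$ is finite for all $\lambda\in(0,\lambda_0)$, and (A3) is a necessary condition for the existence of such a $\lambda_0$.
   Context: $|\cdot|$ is Lebesgue measure on $\mathbb{R}^d$, $\|\cdot\|$ the Euclidean norm, and $B(x,r)$ is the open Euclidean ball with center $x$ and radius $r$. Locally finite on $(0,+\infty)$ means finite on compact subsets of $(0,+\infty)$. For $\lambda>0$, $\xi$ is a Poisson point process on $\mathbb{R}^d\times(0,+\infty)$ whose intensity measure is the product of $\lambda|\cdot|$ and $\mu$; $P_{\lambda,\mu}$ and $E_{\lambda,\mu}$ are the associated probability and expectation. Set $\Sigma=\bigcup_{(c,r)\in\xi}B(c,r)$, let $S$ be the connected component of $\Sigma$ containing $0$ ($S=\varnothing$ if $0\notin\Sigma$), and let $M=\sup_{x\in S}\|x\|\in[0,+\infty]$ ($M=0$ if $S=\varnothing$). *)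

theory Defs
  imports "HOL-Probability.Probability"
begin

text \<open>
  A Poisson point process with intensity \<open>\<nu>\<close> is modelled as a random set of points. Multiplicities are
  not recorded; this loses nothing for a diffuse \<sigma>-finite intensity (such as \<open>boolean_intensity\<close>
  below), for which a Poisson process is almost surely simple.
\<close>

definition num_points :: "'b set \<Rightarrow> 'b set \<Rightarrow> ennreal" where
  "num_points X A = emeasure (count_space UNIV) (X \<inter> A)"

locale poisson_point_process = prob_space P
  for P :: "'w measure" +
  fixes \<nu> :: "'b measure" and \<xi> :: "'w \<Rightarrow> 'b set"
  assumes points_in_space: "\<omega> \<in> space P \<Longrightarrow> \<xi> \<omega> \<subseteq> space \<nu>"
    and measurable_num_points:
      "A \<in> sets \<nu> \<Longrightarrow> (\<lambda>\<omega>. num_points (\<xi> \<omega>) A) \<in> borel_measurable P"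
    and poisson_distributed:
      "\<lbrakk>A \<in> sets \<nu>; emeasure \<nu> A < \<infinity>\<rbrakk> \<Longrightarrow>
         measure P {\<omega> \<in> space P. num_points (\<xi> \<omega>) A = of_nat k} =
           exp (- measure \<nu> A) * measure \<nu> A ^ k / fact k"
    and infinitely_many_points:
      "\<lbrakk>A \<in> sets \<nu>; emeasure \<nu> A = \<infinity>\<rbrakk> \<Longrightarrow> AE \<omega> in P. num_points (\<xi> \<omega>) A = \<infinity>"
    and independent_num_points:
      "\<lbrakk>finite (I :: nat set); disjoint_family_on B I; \<And>i. i \<in> I \<Longrightarrow> B i \<in> sets \<nu>\<rbrakk> \<Longrightarrow>
         indep_vars (\<lambda>_. borel) (\<lambda>i \<omega>. num_points (\<xi> \<omega>) (B i)) I"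

definition locally_finite_pos :: "real measure \<Rightarrow> bool" where
  "locally_finite_pos \<mu> \<longleftrightarrow>
     sets \<mu> = sets (restrict_space borel {0<..}) \<and>
     (\<forall>K. compact K \<and> K \<subseteq> {0<..} \<longrightarrow> emeasure \<mu> K < \<infinity>)"

definition boolean_intensity ::
    "real \<Rightarrow> real measure \<Rightarrow> ((real ^ 'n) \<times> real) measure" where
  "boolean_intensity lam \<mu> = scale_measure (ennreal lam) lborel \<Otimes>\<^sub>M \<mu>"

definition covered_set :: "((real ^ 'n) \<times> real) set \<Rightarrow> (real ^ 'n) set" where
  "covered_set X = (\<Union>(c, r)\<in>X. ball c r)"

text \<open>\<^const>\<open>connected_component_set\<close> is empty when the base point lies outside the set.\<close>

definition origin_component :: "((real ^ 'n) \<times> real) set \<Rightarrow> (real ^ 'n) set" where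
  "origin_component X = connected_component_set (covered_set X) 0"

text \<open>The supremum is taken in \<open>[0, \<infinity>]\<close>, so it is \<open>0\<close> for the empty component.\<close>

definition component_radius :: "((real ^ 'n) \<times> real) set \<Rightarrow> ennreal" where
  "component_radius X = (SUP x\<in>origin_component X. ennreal (norm x))"

text \<open>Powers on \<open>[0, \<infinity>]\<close> with exponent \<open>s > 0\<close>; in particular \<open>\<infinity>\<close> to the power \<open>s\<close> is \<open>\<infinity>\<close>.\<close>

definition ennreal_powr :: "ennreal \<Rightarrow> real \<Rightarrow> ennreal" where
  "ennreal_powr x s = (if x = \<infinity> then \<infinity> else ennreal (enn2real x powr s))"

definition radius_moment ::
    "'w measure \<Rightarrow> ('w \<Rightarrow> ((real ^ 'n) \<times> real) set) \<Rightarrow> real \<Rightarrow> ennreal" where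
  "radius_moment P \<xi> s = (\<integral>\<^sup>+ \<omega>. ennreal_powr (component_radius (\<xi> \<omega>)) s \<partial>P)"

definition tail_condition :: "nat \<Rightarrow> real measure \<Rightarrow> bool" where
  "tail_condition d \<mu> \<longleftrightarrow> (SUP r\<in>{0<..}. ennreal (r ^ d) * emeasure \<mu> {r..}) < \<infinity>"

definition moment_condition :: "nat \<Rightarrow> real \<Rightarrow> real measure \<Rightarrow> bool" where
  "moment_condition d s \<mu> \<longleftrightarrow>
     (\<integral>\<^sup>+ \<beta>\<in>{1..}. ennreal (\<beta> powr (real d + s)) \<partial>\<mu>) < \<infinity>"

end

theory Submission
  imports Defs
begin

text \<open>
  Necessity of (A3): whether a ball with radius in \<open>[10\<^sup>k, 10\<^sup>k\<^sup>+\<^sup>1)\<close> covers the origin depends on a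
  Poisson count whose mean is of order \<open>10\<^sup>k\<^sup>d \<mu> [10\<^sup>k, 10\<^sup>k\<^sup>+\<^sup>1)\<close>, and then \<open>M\<close> is at least of order \<open>10\<^sup>k\<close>.

  Necessity of (A1): if \<open>r\<^sup>d \<mu> [r, \<infinity>)\<close> is large for some \<open>r\<close>, a planar grid of cubes of side of order
  \<open>r\<close> has very few cubes without the centre of a ball of radius at least \<open>r\<close>. Group the cubes into
  3 x 3 blocks, these again into 3 x 3 blocks, and so on, and call a block bad if two of its
  subblocks are bad. Bad probabilities satisfy \<open>p' \<le> 81 p\<^sup>2\<close>, and adjacent good blocks have connected
  cores, so that \<open>M = \<infinity>\<close> has probability at least \<open>1/2\<close>. This replaces the usual contour argument.

  Sufficiency: only radii at least \<open>\<delta>\<close> are considered first. A chain of balls crossing an annulus of size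
  \<open>10 a\<close> either uses a radius in \<open>[a, 10 a)\<close> or contains two crossings at scale \<open>a\<close> that are determined
  by disjoint regions. Hence the crossing probabilities satisfy
  \<open>f (10 a) \<le> N \<lambda> a\<^sup>d \<mu> [a, 10 a) + (N f a)\<^sup>2\<close>; by (A1) they stay small uniformly in \<open>\<delta>\<close> if \<open>\<lambda>\<close> is small,
  and (A3) makes \<open>\<Sum>n. 10\<^sup>n\<^sup>s f (10\<^sup>n)\<close> finite.
\<close>

section \<open>Hitting events of a Poisson process and their independence\<close>

context poisson_point_process
begin

definition hit :: "'b set \<Rightarrow> 'w set" where
  "hit A = {\<omega> \<in> space P. \<xi> \<omega> \<inter> A \<noteq> {}}"

lemma num_points_eq_0_iff: "num_points X A = 0 \<longleftrightarrow> X \<inter> A = {}"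
  by (simp add: num_points_def emeasure_count_space_eq_0)

lemma hit_eq: "hit A = {\<omega> \<in> space P. num_points (\<xi> \<omega>) A \<noteq> 0}"
  by (simp add: hit_def num_points_eq_0_iff)

lemma hit_in_events [measurable]: "A \<in> sets \<nu> \<Longrightarrow> hit A \<in> events"
  unfolding hit_eq using measurable_num_points[of A] by measurable

lemma prob_hit:
  assumes "A \<in> sets \<nu>" "emeasure \<nu> A < \<infinity>"
  shows "prob (hit A) = 1 - exp (- measure \<nu> A)"
proof -
  have "prob (hit A) = 1 - prob {\<omega> \<in> space P. num_points (\<xi> \<omega>) A = of_nat 0}"
    using prob_compl[OF hit_in_events[OF assms(1)]]
    by (auto simp: hit_eq intro!: arg_cong[where f=prob] simp: Diff_eq Int_def dest: sym)
      (smt (verit) Collect_cong mem_Collect_eq)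
  then show ?thesis using poisson_distributed[OF assms, of 0] by simp
qed

lemma prob_hit_le:
  assumes "A \<in> sets \<nu>" "emeasure \<nu> A < \<infinity>"
  shows "prob (hit A) \<le> measure \<nu> A"
  using exp_ge_add_one_self[of "- measure \<nu> A"] by (simp add: prob_hit[OF assms])

text \<open>The locale assumption speaks of finite families indexed by natural numbers. Independence
  of events only concerns finite subfamilies, so a countable index type reduces to it through
  \<open>to_nat\<close>.\<close>

lemma indep_events_hit:
  fixes B :: "'i::countable \<Rightarrow> 'b set"
  assumes disj: "disjoint_family B" and B: "\<And>i. B i \<in> sets \<nu>"
  shows "indep_events (\<lambda>i. hit (B i)) UNIV"
  unfolding indep_events_def
proof (intro conjI allI impI)
  show "(\<lambda>i. hit (B i)) ` UNIV \<subseteq> events" using B by auto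
  fix J :: "'i set" assume J: "J \<noteq> {}" "finite J"
  let ?N = "\<lambda>k \<omega>. num_points (\<xi> \<omega>) (B (from_nat k))"
  have "indep_vars (\<lambda>_. borel) ?N (to_nat ` J)"
    using J disj B by (intro independent_num_points) (auto simp: disjoint_family_on_def)
  then have "indep_sets (\<lambda>k. {?N k -` A \<inter> space P |A. A \<in> sets borel}) (to_nat ` J)"
    by (simp add: indep_vars_def2)
  \<comment> \<open>Hitting is the preimage of \<open>- {0}\<close> under the count, hence belongs
    to the sigma-algebra of that count.\<close>
  then have "indep_sets (\<lambda>k. {hit (B (from_nat k))}) (to_nat ` J)"
    by (rule indep_sets_mono_sets) (auto simp: hit_eq intro!: exI[of _ "- {0}"])
  then have "prob (\<Inter>k\<in>to_nat ` J. hit (B (from_nat k))) = (\<Prod>k\<in>to_nat ` J. prob (hit (B (from_nat k))))"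
    using J unfolding indep_events_def_alt[symmetric] indep_events_def by blast
  then show "prob (\<Inter>j\<in>J. hit (B j)) = (\<Prod>j\<in>J. prob (hit (B j)))"
    by (simp add: prod.reindex inj_on_def)
qed

text \<open>Independent events, grouped by disjoint index sets, generate independent sigma-algebras,
  the singletons being trivially intersection-stable. Disjointness of the cells that decide two
  events thus becomes a product of probabilities.\<close>

lemma prob_Int_hit_sigma:
  fixes B :: "'i::countable \<Rightarrow> 'b set"
  assumes disj: "disjoint_family B" and B: "\<And>i. B i \<in> sets \<nu>" and "I \<inter> J = {}"
    and S: "S \<in> sigma_sets (space P) ((\<lambda>i. hit (B i)) ` I)"
    and T: "T \<in> sigma_sets (space P) ((\<lambda>i. hit (B i)) ` J)"
  shows "prob (S \<inter> T) = prob S * prob T"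
proof -
  have "indep_sets (\<lambda>b. sigma_sets (space P) (\<Union>i\<in>(case b of True \<Rightarrow> I | False \<Rightarrow> J). {hit (B i)})) UNIV"
  proof (rule indep_sets_collect_sigma)
    show "indep_sets (\<lambda>i. {hit (B i)}) (\<Union>b. case b of True \<Rightarrow> I | False \<Rightarrow> J)"
      using indep_events_hit[OF disj B] unfolding indep_events_def_alt
      by (rule indep_sets_mono_index[rotated]) auto
    show "Int_stable {hit (B i)}" for i by (simp add: Int_stable_def)
    show "disjoint_family_on (case_bool I J) UNIV"
      using \<open>I \<inter> J = {}\<close> by (auto simp: disjoint_family_on_def split: bool.splits)
  qed
  moreover have "(\<Union>i\<in>K. {hit (B i)}) = (\<lambda>i. hit (B i)) ` K" for K by auto
  ultimately have "indep_set (sigma_sets (space P) ((\<lambda>i. hit (B i)) ` I))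
      (sigma_sets (space P) ((\<lambda>i. hit (B i)) ` J))"
    unfolding indep_set_def by (auto cong: bool.case_cong elim!: back_subst[of "\<lambda>F. indep_sets F UNIV"] split: bool.splits)
  from indep_setD[OF this S T] show ?thesis .
qed

lemma hit_sigma_sets_in_events:
  assumes "\<And>i. B i \<in> sets \<nu>" "S \<in> sigma_sets (space P) ((\<lambda>i. hit (B i)) ` I)"
  shows "S \<in> events"
  using assms hit_in_events sets.sigma_sets_subset[of "(\<lambda>i. hit (B i)) ` I" P] by blast

end

subsection \<open>Cubes and the intensity measure\<close>

text \<open>Half-open, so that for \<open>a > 0\<close> the cubes partition the space and every
  point has exactly one integer position.\<close>

definition cube :: "real \<Rightarrow> int ^ 'n \<Rightarrow> (real ^ 'n) set" where
  "cube a v = {x. \<forall>i. a * of_int (v $ i) \<le> x $ i \<and> x $ i < a * (of_int (v $ i) + 1)}"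

text \<open>Side length and smallest radius share the scale \<open>a\<close>. The ratio 10 lets the
  radius ranges at the scales \<open>\<delta> * 10 ^ k\<close> tile \<open>{\<delta>..}\<close> when
  \<open>\<delta> > 0\<close>.\<close>

definition cell :: "real \<Rightarrow> int ^ 'n \<Rightarrow> ((real ^ 'n) \<times> real) set" where
  "cell a v = cube a v \<times> {a..<10 * a}"

lemma mem_cube_iff_floor:
  assumes "a > 0"
  shows "x \<in> cube a v \<longleftrightarrow> v = (\<chi> i. \<lfloor>x $ i / a\<rfloor>)"
proof -
  have "a * of_int k \<le> t \<and> t < a * (of_int k + 1) \<longleftrightarrow> k = \<lfloor>t / a\<rfloor>" for k :: int and t :: real
    using assms by (auto simp: eq_commute[of k] floor_eq_iff field_simps)
  then show ?thesis by (simp add: cube_def vec_eq_iff)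
qed

lemma sets_cube [measurable]: "cube a v \<in> sets borel"
  unfolding cube_def by measurable

text \<open>The cube is squeezed between the open and the closed box with the same corners, whose
  volumes agree.\<close>

lemma emeasure_cube:
  fixes v :: "int ^ 'n"
  assumes "a > 0"
  shows "emeasure lborel (cube a v) = ennreal (a ^ CARD('n))"
proof -
  let ?l = "\<chi> i. a * of_int (v $ i)" and ?u = "\<chi> i. a * (of_int (v $ i) + 1)"
  have le: "l \<bullet> b \<le> u \<bullet> b" if "b \<in> Basis" "l = ?l" "u = ?u" for l u b :: "real ^ 'n"
    using that assms by (auto simp: Basis_vec_def inner_axis)
  have prod: "(\<Prod>b\<in>Basis. (?u - ?l) \<bullet> b) = a ^ CARD('n)"
  proof -
    have "(?u - ?l) \<bullet> b = a" if "b \<in> Basis" for b :: "real ^ 'n"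
      using that by (auto simp: Basis_vec_def inner_axis algebra_simps)
    then show ?thesis by simp
  qed
  have "emeasure lborel (box ?l ?u) = ennreal (a ^ CARD('n))"
    "emeasure lborel (cbox ?l ?u) = ennreal (a ^ CARD('n))"
    using emeasure_lborel_box[of ?l ?u] emeasure_lborel_cbox[of ?l ?u] le prod by auto
  moreover have "emeasure lborel (box ?l ?u) \<le> emeasure lborel (cube a v)"
    by (rule emeasure_mono) (auto simp: cube_def mem_box_cart less_imp_le)
  moreover have "emeasure lborel (cube a v) \<le> emeasure lborel (cbox ?l ?u)"
    by (rule emeasure_mono) (auto simp: cube_def mem_box_cart less_imp_le)
  ultimately show ?thesis by simp
qed

lemma infnorm_vec_le_iff: "infnorm (x :: real ^ 'n) \<le> b \<longleftrightarrow> (\<forall>i. \<bar>x $ i\<bar> \<le> b)"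
  unfolding infnorm_cart setcompr_eq_image Collect_mem_eq by (subst cSup_le_iff) auto

lemma infnorm_vec_attained: "\<exists>i. infnorm (x :: real ^ 'n) = \<bar>x $ i\<bar>"
proof -
  have "Sup (range (\<lambda>i. \<bar>x $ i\<bar>)) \<in> range (\<lambda>i. \<bar>x $ i\<bar>)"
    by (subst cSup_eq_Max) (auto intro!: Max_in)
  then show ?thesis by (auto simp: infnorm_cart full_SetCompr_eq)
qed

lemma locally_finite_posD:
  assumes "locally_finite_pos \<mu>"
  shows "sets \<mu> = sets (restrict_space borel {0<..})" "space \<mu> = {0<..}"
    "0 < a \<Longrightarrow> emeasure \<mu> {a..b} < \<infinity>"
    "A \<in> sets borel \<Longrightarrow> A \<subseteq> {0<..} \<Longrightarrow> A \<in> sets \<mu>"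
    "sigma_finite_measure \<mu>"
proof -
  show *: "sets \<mu> = sets (restrict_space borel {0<..})"
    using assms by (simp add: locally_finite_pos_def)
  show sp: "space \<mu> = {0<..}"
    using sets_eq_imp_space_eq[OF *] by (simp add: space_restrict_space)
  show fin: "emeasure \<mu> {a..b} < \<infinity>" if "0 < a" for a b
    using assms that unfolding locally_finite_pos_def by (meson atLeastAtMost_iff compact_Icc greaterThan_iff less_le_trans subsetI)
  show meas: "A \<in> sets \<mu>" if "A \<in> sets borel" "A \<subseteq> {0<..}" for A
    using that by (auto simp: * sets_restrict_space)
  show "sigma_finite_measure \<mu>"
  proof
    \<comment> \<open>A countable exhaustion of the open half-line by compact intervals.\<close>
    let ?A = "range (\<lambda>n. {1 / real (Suc n)..real (Suc n)})"
    have "x \<in> \<Union>?A" if x: "0 < x" for x :: real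
    proof -
      obtain n where n: "1 / x < real n" using reals_Archimedean2 by blast
      obtain m where m: "x < real m" using reals_Archimedean2 by blast
      have "1 / real (Suc (max m n)) \<le> x"
      proof -
        have "1 / x < real (Suc (max m n))" using n by (simp add: max_def)
        with x show ?thesis by (simp add: field_simps)
      qed
      moreover have "x \<le> real (Suc (max m n))" using m by simp
      ultimately show ?thesis by (intro UN_I[of "max m n"]) auto
    qed
    moreover have pos: "0 < x" if "x \<in> {1 / real (Suc n)..real (Suc n)}" for x n
      using that by (auto intro: less_le_trans[of 0 "1 / real (Suc n)"])
    then have "?A \<subseteq> sets \<mu>" by (intro image_subsetI meas) auto
    moreover have "emeasure \<mu> {1 / real (Suc n)..real (Suc n)} < \<infinity>" for n
      by (rule fin) simp
    ultimately show "\<exists>A. countable A \<and> A \<subseteq> sets \<mu> \<and> \<Union>A = space \<mu> \<and> (\<forall>a\<in>A. emeasure \<mu> a \<noteq> \<infinity>)"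
      using pos by (intro exI[of _ ?A] conjI) (auto 0 3 simp: sp less_top[symmetric])
  qed
qed

lemma space_boolean_intensity:
  "locally_finite_pos \<mu> \<Longrightarrow> space (boolean_intensity lam \<mu> :: ((real ^ 'n) \<times> real) measure) = UNIV \<times> {0<..}"
  unfolding boolean_intensity_def space_pair_measure space_scale_measure locally_finite_posD(2) by simp

lemma times_in_sets_boolean_intensity:
  assumes "locally_finite_pos \<mu>" "A \<in> sets borel" "J \<in> sets borel" "J \<subseteq> {0<..}"
  shows "A \<times> J \<in> sets (boolean_intensity lam \<mu> :: ((real ^ 'n) \<times> real) measure)"
  unfolding boolean_intensity_def
  using assms(2) locally_finite_posD(4)[OF assms(1,3,4)] by (intro pair_measureI) simp_all

lemma emeasure_boolean_intensity_times:
  assumes "locally_finite_pos \<mu>" "A \<in> sets borel" "J \<in> sets borel" "J \<subseteq> {0<..}"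
  shows "emeasure (boolean_intensity lam \<mu> :: ((real ^ 'n) \<times> real) measure) (A \<times> J) =
    ennreal lam * emeasure lborel A * emeasure \<mu> J"
proof -
  interpret sigma_finite_measure \<mu> using locally_finite_posD(5) assms(1) .
  show ?thesis
    unfolding boolean_intensity_def
    using assms(2) locally_finite_posD(4)[OF assms(1,3,4)]
    by (subst emeasure_pair_measure_Times) simp_all
qed

lemma emeasure_cube_times:
  fixes v :: "int ^ 'n"
  assumes "locally_finite_pos \<mu>" "J \<in> sets borel" "J \<subseteq> {0<..}" "emeasure \<mu> J < \<infinity>" "a > 0" "lam > 0"
  shows "cube a v \<times> J \<in> sets (boolean_intensity lam \<mu>)"
    "emeasure (boolean_intensity lam \<mu>) (cube a v \<times> J) < \<infinity>"
    "measure (boolean_intensity lam \<mu>) (cube a v \<times> J) = lam * a ^ CARD('n) * measure \<mu> J"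
proof -
  show "cube a v \<times> J \<in> sets (boolean_intensity lam \<mu>)"
    using assms by (intro times_in_sets_boolean_intensity) auto
  have eq: "emeasure (boolean_intensity lam \<mu>) (cube a v \<times> J) = ennreal (lam * a ^ CARD('n) * measure \<mu> J)"
    using assms emeasure_eq_ennreal_measure[of \<mu> J]
    by (subst emeasure_boolean_intensity_times) (auto simp: emeasure_cube ennreal_mult less_top[symmetric])
  then show "emeasure (boolean_intensity lam \<mu>) (cube a v \<times> J) < \<infinity>" by simp
  show "measure (boolean_intensity lam \<mu>) (cube a v \<times> J) = lam * a ^ CARD('n) * measure \<mu> J"
    using assms unfolding measure_def eq by simp
qed

lemma emeasure_shell_finite:
  assumes "locally_finite_pos \<mu>" "a > 0"
  shows "emeasure \<mu> {a..<10 * a} < \<infinity>"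
proof -
  have "{a..10 * a} \<in> sets \<mu>"
    using assms(2) by (intro locally_finite_posD(4)[OF assms(1)]) auto
  then have "emeasure \<mu> {a..<10 * a} \<le> emeasure \<mu> {a..10 * a}"
    by (rule emeasure_mono[rotated]) auto
  also have "\<dots> < \<infinity>" using locally_finite_posD(3)[OF assms] .
  finally show ?thesis .
qed

lemma measure_cell:
  fixes v :: "int ^ 'n"
  assumes "locally_finite_pos \<mu>" "a > 0" "lam > 0"
  shows "cell a v \<in> sets (boolean_intensity lam \<mu>)"
    "emeasure (boolean_intensity lam \<mu>) (cell a v) < \<infinity>"
    "measure (boolean_intensity lam \<mu>) (cell a v) = lam * (a ^ CARD('n) * measure \<mu> {a..<10 * a})"
proof -
  have "{a..<10 * a} \<subseteq> {0<..}" using assms(2) by auto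
  note * = emeasure_cube_times[OF assms(1) _ this emeasure_shell_finite[OF assms(1,2)] assms(2,3), of v]
  from * show "cell a v \<in> sets (boolean_intensity lam \<mu>)"
    "emeasure (boolean_intensity lam \<mu>) (cell a v) < \<infinity>"
    "measure (boolean_intensity lam \<mu>) (cell a v) = lam * (a ^ CARD('n) * measure \<mu> {a..<10 * a})"
    unfolding cell_def mult.assoc by simp_all
qed

subsection \<open>Moments along decimal scales\<close>

lemma ex_decimal_shell:
  assumes "x \<ge> (1::real)"
  shows "\<exists>k. x \<in> {10 ^ k..<10 * 10 ^ k}"
proof -
  define k where "k = (LEAST k. x < 10 ^ Suc k)"
  obtain n where "x < 10 ^ n" using real_arch_pow[of 10 x] by auto
  also have "10 ^ n \<le> (10::real) ^ Suc n" by simp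
  finally have 1: "x < 10 ^ Suc k" unfolding k_def by (rule LeastI)
  have "10 ^ k \<le> x"
  proof (cases k)
    case (Suc j)
    then have "\<not> x < 10 ^ Suc j" using not_less_Least[of j "\<lambda>k. x < 10 ^ Suc k"] by (auto simp: k_def)
    then show ?thesis using Suc by simp
  qed (use assms in simp)
  with 1 show ?thesis by auto
qed

lemma decimal_shells_disjoint: "disjoint_family (\<lambda>k. {a * 10 ^ k..<a * (10 * 10 ^ k) :: real})"
proof (cases "a > 0")
  case True
  have "{a * 10 ^ j..<a * (10 * 10 ^ j)} \<inter> {a * 10 ^ k..<a * (10 * 10 ^ k)} = {}" if "j < k" for j k :: nat
  proof -
    have "10 ^ Suc j \<le> (10::real) ^ k" using that by (intro power_increasing) auto
    then have "a * (10 * 10 ^ j) \<le> a * 10 ^ k" using True by simp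
    then show ?thesis by auto
  qed
  then show ?thesis unfolding disjoint_family_on_def
    by (metis Int_commute nat_neq_iff)
next
  case False
  \<comment> \<open>For \<open>a \<le> 0\<close> all shells are empty.\<close>
  then have "a * (10 * 10 ^ k) \<le> a * 10 ^ k" for k :: nat
    by (intro mult_left_mono_neg) auto
  then show ?thesis by (auto simp: disjoint_family_on_def)
qed

text \<open>On the \<open>k\<close>-th decimal shell the integrand equals
  \<open>(10 powr s) ^ k * (10 ^ k) ^ d\<close> up to a factor between 1 and
  \<open>10 powr (d + s)\<close>. Both directions of the theorem use (A3) in this series
  form.\<close>

lemma moment_condition_iff_summable:
  assumes "locally_finite_pos \<mu>" "s > 0"
  shows "moment_condition d s \<mu> \<longleftrightarrow>
    summable (\<lambda>k. (10 powr s) ^ k * ((10 ^ k) ^ d * measure \<mu> {10 ^ k..<10 * 10 ^ k}))"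
    (is "_ \<longleftrightarrow> summable ?f")
proof -
  let ?B = "\<lambda>k::nat. {10 ^ k..<10 * 10 ^ k :: real}"
  have B: "?B k \<in> sets \<mu>" for k
    by (intro locally_finite_posD(4)[OF assms(1)]) (auto intro: less_le_trans)
  have pos: "0 \<le> \<beta>" if "10 ^ k \<le> \<beta>" for k :: nat and \<beta> :: real
    using that order_trans[of 0 "10 ^ k" \<beta>] by simp
  have fin: "emeasure \<mu> (?B k) = ennreal (measure \<mu> (?B k))" for k
    using emeasure_shell_finite[OF assms(1), of "10 ^ k"] by (intro emeasure_eq_ennreal_measure) auto
  have meas: "(\<lambda>\<beta>. ennreal (\<beta> powr t)) \<in> borel_measurable \<mu>" for t
  proof -
    have "(\<lambda>\<beta>. ennreal (\<beta> powr t)) \<in> borel_measurable (restrict_space borel {0<..})"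
      by (intro measurable_restrict_space1) measurable
    then show ?thesis by (subst measurable_cong_sets[OF locally_finite_posD(1)[OF assms(1)] refl])
  qed
  have Un: "(\<Union>k. ?B k) = {1..}"
  proof (intro equalityI subsetI)
    fix x :: real assume "x \<in> (\<Union>k. ?B k)"
    then obtain k :: nat where "10 ^ k \<le> x" by auto
    then show "x \<in> {1..}" using order_trans[of 1 "10 ^ k" x] by simp
  qed (use ex_decimal_shell in auto)
  have split: "(\<integral>\<^sup>+ \<beta>\<in>{1..}. ennreal (\<beta> powr (real d + s)) \<partial>\<mu>) =
    (\<Sum>k. \<integral>\<^sup>+ \<beta>\<in>?B k. ennreal (\<beta> powr (real d + s)) \<partial>\<mu>)"
    using nn_integral_disjoint_family[OF meas B] decimal_shells_disjoint[of 1] unfolding Un[symmetric]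
    by simp
  have pw: "(10 ^ k) powr (real d + s) = (10 powr s) ^ k * (10 ^ k) ^ d" for k :: nat
    by (simp add: powr_add powr_realpow powr_powr flip: powr_realpow)
       (simp add: powr_powr powr_add mult.commute flip: powr_realpow)
  have lower: "ennreal (?f k) \<le> (\<integral>\<^sup>+ \<beta>\<in>?B k. ennreal (\<beta> powr (real d + s)) \<partial>\<mu>)" for k
  proof -
    have "ennreal (?f k) = ennreal ((10 ^ k) powr (real d + s)) * emeasure \<mu> (?B k)"
      by (simp add: fin pw mult.assoc flip: ennreal_mult)
    also have "\<dots> = (\<integral>\<^sup>+ \<beta>. ennreal ((10 ^ k) powr (real d + s)) * indicator (?B k) \<beta> \<partial>\<mu>)"
      using B by (subst nn_integral_cmult_indicator) auto
    also have "\<dots> \<le> (\<integral>\<^sup>+ \<beta>\<in>?B k. ennreal (\<beta> powr (real d + s)) \<partial>\<mu>)"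
      using assms(2) by (intro nn_integral_mono) (auto split: split_indicator intro!: ennreal_leI powr_mono2)
    finally show ?thesis .
  qed
  have upper: "(\<integral>\<^sup>+ \<beta>\<in>?B k. ennreal (\<beta> powr (real d + s)) \<partial>\<mu>) \<le> ennreal (10 powr (real d + s) * ?f k)" for k
  proof -
    have "(\<integral>\<^sup>+ \<beta>\<in>?B k. ennreal (\<beta> powr (real d + s)) \<partial>\<mu>) \<le>
        (\<integral>\<^sup>+ \<beta>. ennreal ((10 * 10 ^ k) powr (real d + s)) * indicator (?B k) \<beta> \<partial>\<mu>)"
    proof (intro nn_integral_mono)
      fix \<beta> :: real
      have "\<beta> powr (real d + s) \<le> (10 * 10 ^ k) powr (real d + s)" if "\<beta> \<in> ?B k"
        using that pos[of k \<beta>] assms(2) by (intro powr_mono2) simp_all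
      then show "ennreal (\<beta> powr (real d + s)) * indicator (?B k) \<beta> \<le>
          ennreal ((10 * 10 ^ k) powr (real d + s)) * indicator (?B k) \<beta>"
        by (cases "\<beta> \<in> ?B k") (simp_all add: ennreal_leI)
    qed
    also have "\<dots> = ennreal ((10 * 10 ^ k) powr (real d + s)) * emeasure \<mu> (?B k)"
      using B by (subst nn_integral_cmult_indicator) auto
    also have "\<dots> = ennreal (10 powr (real d + s) * ?f k)"
      by (simp add: fin pw powr_mult mult.assoc flip: ennreal_mult)
    finally show ?thesis .
  qed
  have f0: "0 \<le> ?f k" for k by simp
  show ?thesis
  proof
    assume "moment_condition d s \<mu>"
    then have "(\<Sum>k. \<integral>\<^sup>+ \<beta>\<in>?B k. ennreal (\<beta> powr (real d + s)) \<partial>\<mu>) < \<infinity>"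
      unfolding moment_condition_def split .
    then have "(\<Sum>k. ennreal (?f k)) < \<infinity>"
      by (rule order.strict_trans1[OF suminf_le[OF lower summableI summableI]])
    then show "summable ?f"
      unfolding infinity_ennreal_def by (rule summable_suminf_not_top[OF f0 less_imp_neq])
  next
    assume "summable ?f"
    then have *: "summable (\<lambda>k. 10 powr (real d + s) * ?f k)" by (rule summable_mult)
    have "(\<Sum>k. \<integral>\<^sup>+ \<beta>\<in>?B k. ennreal (\<beta> powr (real d + s)) \<partial>\<mu>) \<le> (\<Sum>k. ennreal (10 powr (real d + s) * ?f k))"
      by (intro suminf_le upper summableI)
    also have "\<dots> = ennreal (\<Sum>k. 10 powr (real d + s) * ?f k)"
      using * f0 by (intro suminf_ennreal2) auto
    also have "\<dots> < \<infinity>" by simp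
    finally show "moment_condition d s \<mu>"
      unfolding moment_condition_def split .
  qed
qed

text \<open>The sum is at most the full geometric sum up to the largest selected index, and that is
  within the factor \<open>q / (q - 1)\<close> of its last term.\<close>

lemma geometric_sum_le:
  fixes q :: real
  assumes "q > 1" "\<And>k. k \<in> A \<Longrightarrow> q ^ k \<le> y" "y \<ge> 0"
  shows "(\<Sum>k<n. q ^ k * indicator A k) \<le> q / (q - 1) * y"
proof (induction n)
  case 0
  then show ?case using assms by simp
next
  case (Suc n)
  show ?case
  proof (cases "n \<in> A")
    case True
    have "(\<Sum>k<Suc n. q ^ k * indicator A k) \<le> (\<Sum>k<Suc n. q ^ k)"
      using assms(1) by (intro sum_mono) (auto split: split_indicator)
    also have "\<dots> = (q ^ Suc n - 1) / (q - 1)"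
      using assms(1) by (subst geometric_sum) auto
    also have "\<dots> \<le> q ^ Suc n / (q - 1)" using assms(1) by (intro divide_right_mono) auto
    also have "\<dots> = q / (q - 1) * q ^ n" by simp
    also have "\<dots> \<le> q / (q - 1) * y" using assms True by (intro mult_left_mono) auto
    finally show ?thesis .
  qed (use Suc in simp)
qed

section \<open>Necessity of the moment condition\<close>

lemma ball_subset_origin_component:
  assumes "(c, r) \<in> X" "ball c r \<inter> origin_component X \<noteq> {}"
  shows "ball c r \<subseteq> origin_component X"
proof -
  have sub: "ball c r \<subseteq> covered_set X" using assms(1) by (auto simp: covered_set_def)
  obtain y where y: "y \<in> ball c r" "y \<in> connected_component_set (covered_set X) 0"
    using assms(2) by (auto simp: origin_component_def)
  have "ball c r \<subseteq> connected_component_set (covered_set X) y"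
    using y(1) sub by (intro connected_component_maximal) auto
  then show ?thesis using connected_component_eq[OF y(2)] by (simp add: origin_component_def)
qed

lemma norm_axis_real: "norm (axis k x :: real ^ 'n) = \<bar>x\<bar>"
  by (simp add: norm_eq_sqrt_inner inner_axis_axis)

text \<open>The ball covers the origin and so lies in its component. Two points of the ball at
  distance \<open>r\<close>, symmetric about \<open>c\<close>, cannot both have norm below
  \<open>r / 2\<close>.\<close>

lemma component_radius_ge:
  fixes c :: "real ^ 'n"
  assumes "(c, r) \<in> X" "norm c < r"
  shows "ennreal (r / 2) \<le> component_radius X"
proof -
  obtain k :: 'n where True by simp
  let ?e = "axis k (r / 2) :: real ^ 'n"
  have r: "r > 0" using assms(2) norm_ge_zero[of c] by linarith
  have "0 \<in> covered_set X" using assms by (force simp: covered_set_def dist_norm)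
  then have "0 \<in> ball c r \<inter> origin_component X"
    using assms(2) by (simp add: origin_component_def dist_norm)
  then have sub: "ball c r \<subseteq> origin_component X"
    using ball_subset_origin_component[OF assms(1)] by blast
  have "c + ?e \<in> ball c r" "c - ?e \<in> ball c r" using r by (auto simp: dist_norm norm_axis_real)
  moreover have "r \<le> norm (c + ?e) + norm (c - ?e)"
  proof -
    have "norm ((c + ?e) - (c - ?e)) = norm (2 *\<^sub>R ?e)"
      by (intro arg_cong[where f=norm]) (simp add: algebra_simps scaleR_2)
    also have "\<dots> = r" using r by (simp add: norm_axis_real)
    finally show ?thesis using norm_triangle_ineq4[of "c + ?e" "c - ?e"] by linarith
  qed
  then have "r / 2 \<le> norm (c + ?e) \<or> r / 2 \<le> norm (c - ?e)" by linarith
  ultimately obtain x where "x \<in> ball c r" "r / 2 \<le> norm x" by blast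
  with sub show ?thesis
    unfolding component_radius_def by (intro SUP_upper2[of x] ennreal_leI) auto
qed

lemma ennreal_powr_ge:
  assumes "0 \<le> m" "ennreal m \<le> M" "s > 0"
  shows "ennreal (m powr s) \<le> ennreal_powr M s"
proof (cases M)
  case (real t)
  then have "m \<le> t" using assms by simp
  then show ?thesis using real assms by (simp add: ennreal_powr_def ennreal_leI powr_mono2)
qed (simp add: ennreal_powr_def)

lemma norm_le_card_infnorm: "norm (x :: real ^ 'n) \<le> CARD('n) * infnorm x"
proof -
  have "norm x \<le> (\<Sum>i\<in>UNIV. \<bar>x $ i\<bar>)" by (rule norm_le_l1_cart)
  also have "\<dots> \<le> (\<Sum>i\<in>(UNIV :: 'n set). infnorm x)"
    by (intro sum_mono component_le_infnorm_cart)
  finally show ?thesis by simp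
qed

lemma moment_condition_necessary:
  fixes \<xi> :: "'w \<Rightarrow> ((real ^ 'n) \<times> real) set"
  assumes lf: "locally_finite_pos \<mu>" and s: "s > 0" and lam: "lam > 0"
    and ppp: "poisson_point_process P (boolean_intensity lam \<mu>) \<xi>"
    and fin: "radius_moment P \<xi> s < \<infinity>"
  shows "moment_condition CARD('n) s \<mu>"
proof -
  interpret poisson_point_process P "boolean_intensity lam \<mu>" \<xi> by fact
  let ?d = "CARD('n)"
  define q where "q = 10 powr s"
  have q: "q > 1" using s by (simp add: q_def)
  \<comment> \<open>The side keeps every centre in the cube within norm \<open>10 ^ k / 2\<close>,
    so each ball counted by \<open>B k\<close> covers the origin; \<open>b k\<close> is the mean
    number of such balls.\<close>
  define B :: "nat \<Rightarrow> ((real ^ 'n) \<times> real) set"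
    where "B k = cube (10 ^ k / (2 * ?d)) 0 \<times> {10 ^ k..<10 * 10 ^ k}" for k
  define b where "b k = lam / (2 * ?d) ^ ?d * ((10 ^ k) ^ ?d * measure \<mu> {10 ^ k..<10 * 10 ^ k})" for k
  have sub: "{10 ^ k..<10 * 10 ^ k :: real} \<subseteq> {0<..}" for k :: nat
    by (auto intro: less_le_trans[of 0 "10 ^ k"])
  have B: "B k \<in> sets (boolean_intensity lam \<mu>)" "emeasure (boolean_intensity lam \<mu>) (B k) < \<infinity>"
    "measure (boolean_intensity lam \<mu>) (B k) = b k" for k
    using emeasure_cube_times[OF lf _ sub emeasure_shell_finite[OF lf] _ lam, of k "10 ^ k / (2 * ?d)" "0 :: int ^ 'n"]
    by (simp_all add: B_def b_def power_divide)
  define p where "p k = prob (hit (B k))" for k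
  have p: "p k = 1 - exp (- b k)" for k
    using prob_hit[OF B(1,2)] by (simp add: p_def B(3))
  have b0: "b k \<ge> 0" for k using lam by (simp add: b_def)
  have rad: "ennreal (10 ^ k / 2) \<le> component_radius (\<xi> \<omega>)" if hit: "\<omega> \<in> hit (B k)" for \<omega> k
  proof -
    obtain c r where cr: "(c, r) \<in> \<xi> \<omega>" "c \<in> cube (10 ^ k / (2 * ?d)) 0" "10 ^ k \<le> r"
      using hit by (auto simp: hit_def B_def)
    have "infnorm c \<le> 10 ^ k / (2 * ?d)"
      using cr(2) by (subst infnorm_vec_le_iff) (auto simp: cube_def abs_of_nonneg intro: less_imp_le)
    then have "?d * infnorm c \<le> ?d * (10 ^ k / (2 * ?d))" by (intro mult_left_mono) auto
    then have "norm c \<le> 10 ^ k / 2" using norm_le_card_infnorm[of c] by simp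
    also have "\<dots> < 10 ^ k" by simp
    finally have "norm c < r" using cr(3) by linarith
    from component_radius_ge[OF cr(1) this] have "ennreal (r / 2) \<le> component_radius (\<xi> \<omega>)" .
    moreover have "ennreal (10 ^ k / 2) \<le> ennreal (r / 2)" using cr(3) by (intro ennreal_leI) simp
    ultimately show ?thesis by (rule order_trans[rotated])
  qed
  define C where "C = q / (q - 1) * 2 powr s"
  have C: "C > 0" using q by (simp add: C_def)
  \<comment> \<open>All scales are charged to the same \<open>M\<close>: each scale \<open>k\<close>
    that is hit has \<open>q ^ k \<le> (2 * M) powr s\<close>, and summing them costs only a
    geometric factor. \<open>C\<close> collects that factor and \<open>2 powr s\<close>.\<close>
  have pw: "(\<Sum>k<n. ennreal (q ^ k / C) * indicator (hit (B k)) \<omega>) \<le> ennreal_powr (component_radius (\<xi> \<omega>)) s"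
    for n \<omega>
  proof (cases "component_radius (\<xi> \<omega>)")
    case (real m)
    have "(\<Sum>k<n. q ^ k * indicator {k. \<omega> \<in> hit (B k)} k) \<le> q / (q - 1) * (2 powr s * m powr s)"
    proof (rule geometric_sum_le[OF q])
      fix k assume "k \<in> {k. \<omega> \<in> hit (B k)}"
      then have "10 ^ k \<le> 2 * m" using rad[of \<omega> k] real by simp
      then have "(10 ^ k) powr s \<le> (2 * m) powr s" using s by (intro powr_mono2) auto
      then show "q ^ k \<le> 2 powr s * m powr s"
        using real by (simp add: q_def powr_mult powr_powr mult.commute flip: powr_realpow)
    qed auto
    then have "(\<Sum>k<n. q ^ k * indicator (hit (B k)) \<omega>) \<le> m powr s * C"
      by (simp add: C_def indicator_def mult_ac cong: if_cong)
    then have "(\<Sum>k<n. q ^ k / C * indicator (hit (B k)) \<omega>) \<le> m powr s"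
      using C by (simp add: sum_divide_distrib[symmetric] pos_divide_le_eq)
    then have "ennreal (\<Sum>k<n. q ^ k / C * indicator (hit (B k)) \<omega>) \<le> ennreal (m powr s)"
      by (rule ennreal_leI)
    also have "ennreal (\<Sum>k<n. q ^ k / C * indicator (hit (B k)) \<omega>) =
        (\<Sum>k<n. ennreal (q ^ k / C * indicator (hit (B k)) \<omega>))"
      using q C by (intro sum_ennreal[symmetric]) auto
    also have "\<dots> = (\<Sum>k<n. ennreal (q ^ k / C) * indicator (hit (B k)) \<omega>)"
      by (intro sum.cong) (auto split: split_indicator)
    finally show ?thesis using real by (simp add: ennreal_powr_def)
  qed (simp add: ennreal_powr_def)
  have "summable (\<lambda>k. q ^ k / C * p k)"
  proof (rule bounded_imp_summable)
    show "0 \<le> q ^ k / C * p k" for k using q C by (simp add: p_def)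
    fix n
    have "ennreal (\<Sum>k\<le>n. q ^ k / C * p k) = (\<Sum>k<Suc n. ennreal (q ^ k / C) * ennreal (p k))"
      unfolding lessThan_Suc_atMost using q C
      by (subst sum_ennreal[symmetric]) (auto simp: p_def simp flip: ennreal_mult)
    also have "\<dots> = (\<Sum>k<Suc n. \<integral>\<^sup>+ \<omega>. ennreal (q ^ k / C) * indicator (hit (B k)) \<omega> \<partial>P)"
      using hit_in_events[OF B(1)]
      by (intro sum.cong) (auto simp: nn_integral_cmult_indicator p_def emeasure_eq_measure)
    also have "\<dots> = (\<integral>\<^sup>+ \<omega>. (\<Sum>k<Suc n. ennreal (q ^ k / C) * indicator (hit (B k)) \<omega>) \<partial>P)"
      using hit_in_events[OF B(1)] by (intro nn_integral_sum[symmetric]) auto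
    also have "\<dots> \<le> radius_moment P \<xi> s"
      unfolding radius_moment_def by (intro nn_integral_mono pw)
    finally show "(\<Sum>k\<le>n. q ^ k / C * p k) \<le> enn2real (radius_moment P \<xi> s)"
      using fin enn2real_mono[of "ennreal (\<Sum>k\<le>n. q ^ k / C * p k)"] q C by (simp add: p_def sum_nonneg)
  qed
  from summable_mult[OF this, of C] have sp: "summable (\<lambda>k. q ^ k * p k)" using C by simp
  \<comment> \<open>Inverting \<open>p k = 1 - exp (- b k)\<close> linearly requires that
    \<open>p k\<close> is eventually small.\<close>
  have "p \<longlonglongrightarrow> 0"
  proof (rule tendsto_sandwich[where f = "\<lambda>_. 0" and h = "\<lambda>k. q ^ k * p k"])
    show "(\<lambda>k. q ^ k * p k) \<longlonglongrightarrow> 0" using sp by (rule summable_LIMSEQ_zero)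
    show "\<forall>\<^sub>F k in sequentially. p k \<le> q ^ k * p k"
    proof (intro always_eventually allI)
      fix k
      have "1 * p k \<le> q ^ k * p k" using q by (intro mult_right_mono one_le_power) (auto simp: p_def)
      then show "p k \<le> q ^ k * p k" by simp
    qed
  qed (auto simp: p_def)
  then have "\<forall>\<^sub>F k in sequentially. p k < 1 / 2" by (rule order_tendstoD) simp
  then have ev: "\<forall>\<^sub>F k in sequentially. norm (q ^ k * b k) \<le> 2 * (q ^ k * p k)"
  proof (rule eventually_mono)
    fix k assume "p k < 1 / 2"
    \<comment> \<open>This gives \<open>b k * exp (- b k) \<le> p k\<close>; since
      \<open>p k < 1 / 2\<close> means \<open>exp (- b k) > 1 / 2\<close>, it follows that
      \<open>b k \<le> 2 * p k\<close>.\<close>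
    have *: "(1 + b k) * exp (- b k) \<le> 1"
      using mult_right_mono[OF exp_ge_add_one_self[of "b k"], of "exp (- b k)"]
      by (simp flip: exp_add)
    have "exp (- b k) * b k + exp (- b k) \<le> 1" using * by (simp add: algebra_simps)
    moreover have "1 / 2 * b k \<le> exp (- b k) * b k"
      using \<open>p k < 1 / 2\<close> b0[of k] p[of k] by (intro mult_right_mono) auto
    ultimately have "b k \<le> 2 * p k" using p[of k] by simp
    then have "q ^ k * b k \<le> q ^ k * (2 * p k)" using q by (intro mult_left_mono) auto
    then show "norm (q ^ k * b k) \<le> 2 * (q ^ k * p k)" using b0[of k] q by simp
  qed
  have "summable (\<lambda>k. q ^ k * b k)"
    by (rule summable_comparison_test_ev[OF ev]) (intro summable_mult sp)
  from summable_mult[OF this, of "(2 * ?d) ^ ?d / lam"]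
  have "summable (\<lambda>k. q ^ k * ((10 ^ k) ^ ?d * measure \<mu> {10 ^ k..<10 * 10 ^ k}))"
    using lam by (simp add: b_def mult_ac)
  then show ?thesis unfolding moment_condition_iff_summable[OF lf s] q_def .
qed

subsection \<open>Good blocks in the planar grid\<close>

definition subblocks :: "nat \<times> nat \<Rightarrow> (nat \<times> nat) set" where
  "subblocks b = (\<lambda>(a, c). (3 * fst b + a, 3 * snd b + c)) ` ({..<3} \<times> {..<3})"

fun bad_block :: "(nat \<times> nat) set \<Rightarrow> nat \<Rightarrow> nat \<times> nat \<Rightarrow> bool" where
  "bad_block X 0 b \<longleftrightarrow> b \<notin> X"
| "bad_block X (Suc n) b \<longleftrightarrow>
    (\<exists>x\<in>subblocks b. \<exists>y\<in>subblocks b. x \<noteq> y \<and> bad_block X n x \<and> bad_block X n y)"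

text \<open>The sites reached through good subblocks only, level by level. At level 0 the core is
  \<open>{b}\<close> whether or not \<open>b\<close> lies in \<open>X\<close>, so inclusion in
  \<open>X\<close> is claimed for good blocks.\<close>

fun block_core :: "(nat \<times> nat) set \<Rightarrow> nat \<Rightarrow> nat \<times> nat \<Rightarrow> (nat \<times> nat) set" where
  "block_core X 0 b = {b}"
| "block_core X (Suc n) b = (\<Union>x\<in>{x \<in> subblocks b. \<not> bad_block X n x}. block_core X n x)"

text \<open>Reflexive, so that connection inside one block and between neighbours is a single
  induction statement. Steps go only right or up because the relations derived from it are
  symmetric.\<close>

definition grid_adj :: "nat \<times> nat \<Rightarrow> nat \<times> nat \<Rightarrow> bool" where
  "grid_adj x y \<longleftrightarrow> y = x \<or> y = (Suc (fst x), snd x) \<or> y = (fst x, Suc (snd x))"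

lemma subblocks_iff: "(a, c) \<in> subblocks (i, j) \<longleftrightarrow> a div 3 = i \<and> c div 3 = j"
proof -
  have *: "(\<exists>k<3. a = 3 * i + k) \<longleftrightarrow> a div 3 = i" for a i :: nat
    by (metis div_mult_mod_eq mod_less_divisor mult.commute div_mult_self4 div_less add.right_neutral zero_less_numeral zero_neq_numeral)
  show ?thesis unfolding subblocks_def using *[of a i] *[of c j] by (auto simp: image_iff)
qed

lemma finite_subblocks: "finite (subblocks b)"
  by (simp add: subblocks_def)

lemma card_subblocks: "card (subblocks b) \<le> 9"
  unfolding subblocks_def by (rule order_trans[OF card_image_le]) auto

lemma subblocksI: "a < 3 \<Longrightarrow> c < 3 \<Longrightarrow> (3 * i + a, 3 * j + c) \<in> subblocks (i, j)"
  by (auto simp: subblocks_iff)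

lemma subblocksE:
  assumes "x \<in> subblocks (i, j)"
  obtains a c where "a < 3" "c < 3" "x = (3 * i + a, 3 * j + c)"
  using assms by (auto simp: subblocks_def)

lemma not_bad_subblock:
  assumes "\<not> bad_block X (Suc n) b" "x \<in> subblocks b" "y \<in> subblocks b" "x \<noteq> y"
  shows "\<not> bad_block X n x \<or> \<not> bad_block X n y"
  using assms by auto

text \<open>Of two distinct subblocks of a good block one is good, and the induction continues
  inside it.\<close>

lemma block_core_nonempty: "\<not> bad_block X n b \<Longrightarrow> block_core X n b \<noteq> {}"
proof (induction n arbitrary: b)
  case (Suc n)
  obtain i j where b: "b = (i, j)" by fastforce
  have sub: "(3 * i, 3 * j) \<in> subblocks b" "(3 * i + 1, 3 * j) \<in> subblocks b"
    by (auto simp: b subblocks_iff)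
  have "\<not> bad_block X n (3 * i, 3 * j) \<or> \<not> bad_block X n (3 * i + 1, 3 * j)"
    by (rule not_bad_subblock[OF Suc.prems sub]) simp
  with sub obtain x where "x \<in> subblocks b" "\<not> bad_block X n x" by blast
  moreover from this obtain y where "y \<in> block_core X n x" using Suc.IH[of x] by blast
  ultimately have "y \<in> block_core X (Suc n) b" by (simp del: split_paired_Ex) blast
  then show ?case by blast
qed simp

lemma block_core_subset: "\<not> bad_block X n b \<Longrightarrow> block_core X n b \<subseteq> X"
  by (induction n arbitrary: b) auto

lemma block_core_fst_ge: "x \<in> block_core X n b \<Longrightarrow> 3 ^ n * fst b \<le> fst x"
proof (induction n arbitrary: b)
  case (Suc n)
  then obtain y where y: "y \<in> subblocks b" "x \<in> block_core X n y" by auto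
  have "3 * fst b \<le> fst y" using y(1) by (auto simp: subblocks_def)
  then have "3 ^ n * (3 * fst b) \<le> 3 ^ n * fst y" by simp
  also have "\<dots> \<le> fst x" by (rule Suc.IH[OF y(2)])
  finally show ?case by (simp add: mult_ac)
qed simp

lemma origin_in_block_core: "(\<And>k. k \<le> n \<Longrightarrow> \<not> bad_block X k (0, 0)) \<Longrightarrow> (0, 0) \<in> block_core X n (0, 0)"
proof (induction n)
  case (Suc n)
  then have "(0, 0) \<in> block_core X n (0, 0)" "\<not> bad_block X n (0, 0)" by auto
  moreover have "(0, 0) \<in> subblocks (0, 0)" by (simp add: subblocks_iff)
  ultimately show ?case by auto
qed simp

text \<open>The right column of subblocks offers two candidates, one of them good. This is the
  source of arbitrarily distant points in the component.\<close>

lemma far_site_in_block_core: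
  assumes "\<not> bad_block X (Suc n) (0, 0)"
  shows "\<exists>x\<in>block_core X (Suc n) (0, 0). 2 * 3 ^ n \<le> fst x"
proof -
  have sub: "(2, 0) \<in> subblocks (0, 0)" "(2, 1) \<in> subblocks (0, 0)" by (auto simp: subblocks_iff)
  have "\<not> bad_block X n (2, 0) \<or> \<not> bad_block X n (2, 1)"
    by (rule not_bad_subblock[OF assms sub]) simp
  then obtain k where k: "(2, k) \<in> subblocks (0, 0)" "\<not> bad_block X n (2, k)" using sub by blast
  obtain x where "x \<in> block_core X n (2, k)" using block_core_nonempty[OF k(2)] by blast
  moreover from this have "2 * 3 ^ n \<le> fst x" using block_core_fst_ge[of x X n "(2, k)"] by (simp add: mult.commute)
  ultimately show ?thesis using k by auto
qed

text \<open>The 3 x 3 grid stays connected when one vertex is removed. Transitivity is assumed only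
  through good vertices, because for cores of blocks it can fail at an empty core.\<close>

lemma grid_minus_vertex_connected:
  fixes L :: "nat \<times> nat \<Rightarrow> nat \<times> nat \<Rightarrow> bool" and good :: "nat \<times> nat \<Rightarrow> bool"
  assumes one: "\<And>x y. x \<in> {..<3} \<times> {..<3} \<Longrightarrow> y \<in> {..<3} \<times> {..<3} \<Longrightarrow> x \<noteq> y \<Longrightarrow> good x \<or> good y"
    and adj: "\<And>x y. good x \<Longrightarrow> good y \<Longrightarrow> grid_adj x y \<Longrightarrow> L x y"
    and sym: "\<And>x y. L x y \<Longrightarrow> L y x"
    and trans: "\<And>x y z. L x y \<Longrightarrow> L y z \<Longrightarrow> good y \<Longrightarrow> L x z"
    and xy: "x \<in> {..<3} \<times> {..<3}" "y \<in> {..<3} \<times> {..<3}" "good x" "good y"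
  shows "L x y"
proof -
  obtain p q where pq: "\<And>x. x \<in> {..<3} \<times> {..<3} \<Longrightarrow> x \<noteq> (p, q) \<Longrightarrow> good x"
    using one by (metis surj_pair)
  have three: "k = 0 \<or> k = 1 \<or> k = 2" if "k < 3" for k :: nat using that by auto
  have line: "L (f a) (f b)"
    if "\<And>k. k < 3 \<Longrightarrow> good (f k)" "grid_adj (f 0) (f 1)" "grid_adj (f 1) (f 2)" "a < 3" "b < 3"
    for f :: "nat \<Rightarrow> nat \<times> nat" and a b
  proof -
    have g: "good (f 0)" "good (f 1)" "good (f 2)" using that(1) by auto
    have r: "L (f k) (f k)" if "good (f k)" for k using adj[OF that that] by (simp add: grid_adj_def)
    have "L (f 0) (f 1)" "L (f 1) (f 2)" using adj g that by auto
    moreover from this have "L (f 0) (f 2)" using trans g(2) by blast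
    ultimately show ?thesis
      using g r[of 0] r[of 1] r[of 2] three[OF that(4)] three[OF that(5)] by (elim disjE) (simp_all add: sym)
  qed
  have row: "L (a, c) (b, c)" if "\<And>k. k < 3 \<Longrightarrow> good (k, c)" "a < 3" "b < 3" for a b c
    using line[of "\<lambda>k. (k, c)"] that by (simp add: grid_adj_def)
  have col: "L (c, a) (c, b)" if "\<And>k. k < 3 \<Longrightarrow> good (c, k)" "a < 3" "b < 3" for a b c
    using line[of "\<lambda>k. (c, k)"] that by (simp add: grid_adj_def)
  \<comment> \<open>Column \<open>a0\<close> and row \<open>b0\<close> avoid the one possible defect
    \<open>(p, q)\<close>; every good vertex gets linked to their intersection.\<close>
  define a0 where "a0 = (if p = 0 then 1 else 0 :: nat)"
  define b0 where "b0 = (if q = 0 then 1 else 0 :: nat)"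
  have a0: "a0 < 3" "a0 \<noteq> p" and b0: "b0 < 3" "b0 \<noteq> q" by (auto simp: a0_def b0_def)
  have base: "L x (a0, b0)" if x: "x \<in> {..<3} \<times> {..<3}" "good x" for x
  proof -
    obtain a b where ab: "x = (a, b)" "a < 3" "b < 3" using x by auto
    have c0: "good (a0, k)" if "k < 3" for k using pq a0 that by auto
    have r0: "good (k, b0)" if "k < 3" for k using pq b0 that by auto
    show ?thesis
    \<comment> \<open>In the defective row but another column, the own column is clean and leads to
      row \<open>b0\<close>. Otherwise the own row is clean: if it contains \<open>(p, q)\<close>,
      then \<open>x\<close> is that vertex and is good.\<close>
    proof (cases "b = q \<and> a \<noteq> p")
      case True
      then have "good (a, k)" if "k < 3" for k using pq ab that by auto
      then have "L (a, b) (a, b0)" using col ab b0 by blast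
      moreover have "L (a, b0) (a0, b0)" using row r0 ab a0 by blast
      ultimately show ?thesis using trans r0 ab by blast
    next
      case False
      then have "good (k, b)" if "k < 3" for k using pq[of "(k, b)"] x(2) ab that by auto
      then have "L (a, b) (a0, b)" using row ab a0 by blast
      moreover have "L (a0, b) (a0, b0)" using col c0 ab b0 by blast
      ultimately show ?thesis using trans c0 ab by blast
    qed
  qed
  have "good (a0, b0)" using pq a0 b0 by auto
  then show ?thesis using base xy sym trans by blast
qed

text \<open>Induction on the level. Inside a block at most one subblock is bad, so
  \<open>grid_minus_vertex_connected\<close> links the good ones; adjacent blocks are bridged by a
  pair of good subblocks facing each other across the common side.\<close>

lemma block_core_linked:
  fixes R :: "nat \<times> nat \<Rightarrow> nat \<times> nat \<Rightarrow> bool"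
  assumes sym: "\<And>x y. R x y \<Longrightarrow> R y x" and trans: "\<And>x y z. R x y \<Longrightarrow> R y z \<Longrightarrow> R x z"
    and adj: "\<And>x y. x \<in> X \<Longrightarrow> y \<in> X \<Longrightarrow> grid_adj x y \<Longrightarrow> R x y"
  shows "\<not> bad_block X n b \<Longrightarrow> \<not> bad_block X n b' \<Longrightarrow> grid_adj b b' \<Longrightarrow>
    x \<in> block_core X n b \<Longrightarrow> y \<in> block_core X n b' \<Longrightarrow> R x y"
proof (induction n arbitrary: b b' x y)
  case 0
  then show ?case using adj by auto
next
  case (Suc n)
  define L where "L u v \<longleftrightarrow> (\<forall>x\<in>block_core X n u. \<forall>y\<in>block_core X n v. R x y)" for u v
  let ?good = "\<lambda>u. \<not> bad_block X n u"
  have Lsym: "L u v \<Longrightarrow> L v u" for u v using sym by (auto simp: L_def)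
  have Ltrans: "L u v \<Longrightarrow> L v w \<Longrightarrow> ?good v \<Longrightarrow> L u w" for u v w
    using block_core_nonempty[of X n v] trans unfolding L_def by blast
  have Ladj: "?good u \<Longrightarrow> ?good v \<Longrightarrow> grid_adj u v \<Longrightarrow> L u v" for u v
    using Suc.IH by (auto simp: L_def)
  have inner: "L u v" if b: "\<not> bad_block X (Suc n) b" and uv: "u \<in> subblocks b" "v \<in> subblocks b" "?good u" "?good v" for b u v
  proof -
    obtain i j where ij: "b = (i, j)" by fastforce
    let ?s = "\<lambda>z. (3 * i + fst z, 3 * j + snd z)"
    obtain u' v' where u': "u' \<in> {..<3} \<times> {..<3}" "u = ?s u'" and v': "v' \<in> {..<3} \<times> {..<3}" "v = ?s v'"
      using uv(1,2) unfolding ij by (fastforce elim!: subblocksE)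
    have "L (?s u') (?s v')"
    proof (rule grid_minus_vertex_connected[where L = "\<lambda>x y. L (?s x) (?s y)" and good = "\<lambda>x. ?good (?s x)"])
      show "?good (?s x) \<or> ?good (?s y)"
        if "x \<in> {..<3} \<times> {..<3}" "y \<in> {..<3} \<times> {..<3}" "x \<noteq> y" for x y :: "nat \<times> nat"
        using that b unfolding ij by (intro not_bad_subblock[of X n "(i, j)"] subblocksI) (auto simp: prod_eq_iff)
      show "L (?s x) (?s y)" if "?good (?s x)" "?good (?s y)" "grid_adj x y" for x y
        using that by (intro Ladj) (auto simp: grid_adj_def)
    qed (use uv u' v' in \<open>auto intro: Lsym Ltrans\<close>)
    then show ?thesis using u' v' by simp
  qed
  obtain u v where u: "u \<in> subblocks b" "?good u" "x \<in> block_core X n u"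
    and v: "v \<in> subblocks b'" "?good v" "y \<in> block_core X n v"
    using Suc.prems by auto
  obtain i j where b: "b = (i, j)" by fastforce
  \<comment> \<open>Three facing pairs, at most one bad subblock on either side: at least one pair
    is good on both sides.\<close>
  have pigeon: "\<exists>k<3. ?good (f k) \<and> ?good (g k)"
    if "\<And>k. k < 3 \<Longrightarrow> f k \<in> subblocks b" "\<And>k. k < 3 \<Longrightarrow> g k \<in> subblocks b'" "inj f" "inj g"
    for f g :: "nat \<Rightarrow> nat \<times> nat"
  proof (rule ccontr)
    assume no: "\<not> ?thesis"
    have f: "?good (f k) \<or> ?good (f l)" if "k < 3" "l < 3" "k \<noteq> l" for k l
      using not_bad_subblock[OF Suc.prems(1), of "f k" "f l"] \<open>\<And>k. k < 3 \<Longrightarrow> f k \<in> subblocks b\<close> that \<open>inj f\<close>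
      by (simp add: inj_eq)
    have g: "?good (g k) \<or> ?good (g l)" if "k < 3" "l < 3" "k \<noteq> l" for k l
      using not_bad_subblock[OF Suc.prems(2), of "g k" "g l"] \<open>\<And>k. k < 3 \<Longrightarrow> g k \<in> subblocks b'\<close> that \<open>inj g\<close>
      by (simp add: inj_eq)
    have fg: "\<not> ?good (f k) \<or> \<not> ?good (g k)" if "k < 3" for k using no that by blast
    show False
      using f[of 0 1] f[of 0 2] f[of 1 2] g[of 0 1] g[of 0 2] g[of 1 2] fg[of 0] fg[of 1] fg[of 2]
      by simp blast
  qed
  have div3: "Suc (Suc (3 * m)) div 3 = m" "(3 * m + 3) div 3 = Suc m" for m :: nat by presburger+
  have "L u v"
  proof -
    from \<open>grid_adj b b'\<close> consider "b' = b" | "b' = (Suc i, j)" | "b' = (i, Suc j)" by (auto simp: grid_adj_def b)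
    then show ?thesis
    proof cases
      case 1
      then show ?thesis using inner Suc.prems u v by blast
    next
      case 2
      obtain k where k: "k < 3" "?good (3 * i + 2, 3 * j + k)" "?good (3 * i + 3, 3 * j + k)"
        using pigeon[of "\<lambda>k. (3 * i + 2, 3 * j + k)" "\<lambda>k. (3 * i + 3, 3 * j + k)"]
        by (auto simp: b 2 div3 subblocks_iff inj_on_def)
      have "L u (3 * i + 2, 3 * j + k)" "L (3 * i + 3, 3 * j + k) v"
        using inner[OF Suc.prems(1) u(1) _ u(2) k(2)] inner[OF Suc.prems(2) _ v(1) k(3) v(2)] k(1)
        by (auto simp: b 2 div3 subblocks_iff)
      moreover have "L (3 * i + 2, 3 * j + k) (3 * i + 3, 3 * j + k)"
        using k by (intro Ladj) (auto simp: grid_adj_def)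
      ultimately show ?thesis using Ltrans k by blast
    next
      case 3
      obtain k where k: "k < 3" "?good (3 * i + k, 3 * j + 2)" "?good (3 * i + k, 3 * j + 3)"
        using pigeon[of "\<lambda>k. (3 * i + k, 3 * j + 2)" "\<lambda>k. (3 * i + k, 3 * j + 3)"]
        by (auto simp: b 3 div3 subblocks_iff inj_on_def)
      have "L u (3 * i + k, 3 * j + 2)" "L (3 * i + k, 3 * j + 3) v"
        using inner[OF Suc.prems(1) u(1) _ u(2) k(2)] inner[OF Suc.prems(2) _ v(1) k(3) v(2)] k(1)
        by (auto simp: b 3 div3 subblocks_iff)
      moreover have "L (3 * i + k, 3 * j + 2) (3 * i + k, 3 * j + 3)"
        using k by (intro Ladj) (auto simp: grid_adj_def)
      ultimately show ?thesis using Ltrans k by blast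
    qed
  qed
  then show ?case using u v by (auto simp: L_def)
qed

subsection \<open>Necessity of the tail condition\<close>

text \<open>Places the planar quadrant in the lattice along the coordinates \<open>k1\<close> and
  \<open>k2\<close>; dimension at least 2 supplies two different ones.\<close>

definition slice_site :: "'n::finite \<Rightarrow> 'n \<Rightarrow> nat \<times> nat \<Rightarrow> int ^ 'n" where
  "slice_site k1 k2 x = (\<chi> k. if k = k1 then int (fst x) else if k = k2 then int (snd x) else 0)"

definition slice_cell :: "'n::finite \<Rightarrow> 'n \<Rightarrow> real \<Rightarrow> real \<Rightarrow> nat \<times> nat \<Rightarrow> ((real ^ 'n) \<times> real) set" where
  "slice_cell k1 k2 \<epsilon> r x = cube \<epsilon> (slice_site k1 k2 x) \<times> {r..}"

lemma cube_unique: "a > 0 \<Longrightarrow> x \<in> cube a v \<Longrightarrow> x \<in> cube a w \<Longrightarrow> v = w"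
  by (simp add: mem_cube_iff_floor)

lemma infnorm_cube_diff_le:
  assumes "\<epsilon> > 0" "c \<in> cube \<epsilon> v" "c' \<in> cube \<epsilon> v'" "\<And>i. \<bar>v $ i - v' $ i\<bar> \<le> 1"
  shows "infnorm (c - c') \<le> 2 * \<epsilon>"
  unfolding infnorm_vec_le_iff
proof
  fix i
  have v: "real_of_int (v $ i) \<le> v' $ i + 1" "real_of_int (v' $ i) \<le> v $ i + 1"
    using assms(4)[of i] by linarith+
  have "\<epsilon> * v $ i \<le> \<epsilon> * (v' $ i + 1)" "\<epsilon> * v' $ i \<le> \<epsilon> * (v $ i + 1)"
    using v assms(1) by (auto intro!: mult_left_mono)
  moreover have "\<epsilon> * v $ i \<le> c $ i" "c $ i < \<epsilon> * v $ i + \<epsilon>" "\<epsilon> * v' $ i \<le> c' $ i" "c' $ i < \<epsilon> * v' $ i + \<epsilon>"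
    using assms(2,3) by (auto simp: cube_def algebra_simps)
  ultimately show "\<bar>(c - c') $ i\<bar> \<le> 2 * \<epsilon>" by (simp add: algebra_simps)
qed

text \<open>With side \<open>r / (4 * CARD('n))\<close>, centres in adjacent cubes are less than
  \<open>r\<close> apart, so balls of adjacent occupied cells overlap. The component of the origin
  therefore spreads over the whole core, out to the far site.\<close>

lemma component_radius_ge_of_good_blocks:
  fixes k1 k2 :: "'n::finite" and X :: "((real ^ 'n) \<times> real) set"
  assumes r: "r > 0" and good: "\<And>k. k \<le> Suc n \<Longrightarrow> \<not> bad_block {x. X \<inter> slice_cell k1 k2 (r / (4 * CARD('n))) r x \<noteq> {}} k (0, 0)"
  shows "ennreal (r / (4 * CARD('n)) * (2 * 3 ^ n)) \<le> component_radius X"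
proof -
  define \<epsilon> where "\<epsilon> = r / (4 * CARD('n))"
  have eps: "\<epsilon> > 0" using r by (simp add: \<epsilon>_def)
  let ?B = "slice_cell k1 k2 \<epsilon> r"
  let ?O = "{x. X \<inter> ?B x \<noteq> {}}"
  let ?T = "origin_component X"
  have near: "dist c c' < r" if "infnorm (c - c') \<le> 2 * \<epsilon>" for c c' :: "real ^ 'n"
  proof -
    have "dist c c' \<le> CARD('n) * infnorm (c - c')"
      unfolding dist_norm by (rule norm_le_card_infnorm)
    also have "\<dots> \<le> CARD('n) * (2 * \<epsilon>)" using that by (intro mult_left_mono) auto
    also have "\<dots> < r" using r by (simp add: \<epsilon>_def)
    finally show ?thesis .
  qed
  \<comment> \<open>All balls of the cell \<open>x\<close> lie in the component of the origin;
    vacuously true at vacant sites, which is why \<open>S_step\<close> asks for an occupied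
    \<open>x\<close>.\<close>
  define S where "S x \<longleftrightarrow> (\<forall>(c, r)\<in>X \<inter> ?B x. ball c r \<subseteq> ?T)" for x
  have S_step: "S y" if "S x" "x \<in> ?O" "grid_adj x y \<or> grid_adj y x" for x y
    unfolding S_def
  proof (clarify)
    fix c t z assume c: "(c, t) \<in> X" "(c, t) \<in> ?B y" and z: "z \<in> ball c t"
    obtain c' t' where c': "(c', t') \<in> X" "(c', t') \<in> ?B x" using \<open>x \<in> ?O\<close> by auto
    have "infnorm (c' - c) \<le> 2 * \<epsilon>"
      using c(2) c'(2) that(3)
      by (intro infnorm_cube_diff_le[OF eps, of _ "slice_site k1 k2 x" _ "slice_site k1 k2 y"])
        (auto simp: slice_cell_def slice_site_def grid_adj_def)
    then have "c \<in> ball c' t'" using near[of c' c] c'(2) by (auto simp: slice_cell_def)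
    moreover have "ball c' t' \<subseteq> ?T" using \<open>S x\<close> c' by (auto simp: S_def)
    moreover have "c \<in> ball c t" using c(2) r by (auto simp: slice_cell_def)
    ultimately have "ball c t \<inter> ?T \<noteq> {}" by blast
    then show "z \<in> ?T" using ball_subset_origin_component[OF c(1)] z by blast
  qed
  \<comment> \<open>Equality of the truth values of \<open>S\<close> is an equivalence relation, so
    \<open>block_core_linked\<close> carries \<open>S\<close> from the origin to every site of the
    core.\<close>
  have linked: "S x \<longleftrightarrow> S y" if "x \<in> block_core ?O (Suc n) (0, 0)" "y \<in> block_core ?O (Suc n) (0, 0)" for x y
  proof (rule block_core_linked[where R = "\<lambda>x y. S x \<longleftrightarrow> S y"])
    show "S u \<longleftrightarrow> S v" if "u \<in> ?O" "v \<in> ?O" "grid_adj u v" for u v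
      using S_step that by blast
    show "\<not> bad_block ?O (Suc n) (0, 0)" "\<not> bad_block ?O (Suc n) (0, 0)"
      using good[of "Suc n"] unfolding \<epsilon>_def by auto
  qed (use that in \<open>auto simp: grid_adj_def\<close>)
  have good': "\<not> bad_block ?O k (0, 0)" if "k \<le> Suc n" for k
    using good[OF that] unfolding \<epsilon>_def .
  have "S (0, 0)"
    unfolding S_def
  proof (clarify)
    fix c t z assume c: "(c, t) \<in> X" "(c, t) \<in> ?B (0, 0)" and z: "z \<in> ball c t"
    have "0 \<in> cube \<epsilon> (slice_site k1 k2 (0, 0))" using eps by (simp add: cube_def slice_site_def)
    then have "infnorm (c - 0) \<le> 2 * \<epsilon>"
      using c(2) by (intro infnorm_cube_diff_le[OF eps]) (auto simp: slice_cell_def)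
    then have "0 \<in> ball c t" using near[of c 0] c(2) by (auto simp: slice_cell_def)
    moreover from this have "0 \<in> ?T" using c(1) by (force simp: origin_component_def covered_set_def)
    ultimately have "ball c t \<subseteq> ?T" by (intro ball_subset_origin_component[OF c(1)]) blast
    then show "z \<in> ?T" using z by blast
  qed
  moreover obtain x where x: "x \<in> block_core ?O (Suc n) (0, 0)" "2 * 3 ^ n \<le> fst x"
    using far_site_in_block_core good' by blast
  moreover have "(0, 0) \<in> block_core ?O (Suc n) (0, 0)" using origin_in_block_core good' by blast
  ultimately have "S x" using linked by blast
  have "x \<in> ?O" using block_core_subset good'[of "Suc n"] x(1) by blast
  then obtain c t where c: "(c, t) \<in> X" "(c, t) \<in> ?B x" by auto
  then have "c \<in> ball c t" using r by (auto simp: slice_cell_def)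
  then have "c \<in> ?T" using \<open>S x\<close> c unfolding S_def by blast
  have "\<epsilon> * (2 * 3 ^ n) \<le> \<epsilon> * fst x"
    using eps x(2) by (intro mult_left_mono) (simp_all flip: of_nat_le_iff[where 'a = real])
  also have "\<dots> \<le> c $ k1" using c(2) by (auto simp: slice_cell_def cube_def slice_site_def dest: spec[of _ k1])
  also have "\<dots> \<le> norm c" using component_le_norm_cart[of c k1] by linarith
  finally have "ennreal (\<epsilon> * (2 * 3 ^ n)) \<le> ennreal (norm c)" by (rule ennreal_leI)
  also have "\<dots> \<le> component_radius X"
    unfolding component_radius_def using \<open>c \<in> ?T\<close> by (rule SUP_upper)
  finally show ?thesis unfolding \<epsilon>_def .
qed

section \<open>Probability of bad blocks\<close>

context poisson_point_process
begin

text \<open>Polymorphic in the index: planar sites for the blocks, pairs of scale and position for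
  the crossings.\<close>

definition occupied :: "('i \<Rightarrow> 'b set) \<Rightarrow> 'w \<Rightarrow> 'i set" where
  "occupied B \<omega> = {i. \<xi> \<omega> \<inter> B i \<noteq> {}}"

definition block_sites :: "nat \<Rightarrow> nat \<times> nat \<Rightarrow> (nat \<times> nat) set" where
  "block_sites n b = {x. fst x div 3 ^ n = fst b \<and> snd x div 3 ^ n = snd b}"

lemma block_sites_disjoint: "b \<noteq> b' \<Longrightarrow> block_sites n b \<inter> block_sites n b' = {}"
  by (auto simp: block_sites_def prod_eq_iff)

lemma block_sites_subblock: "x \<in> subblocks b \<Longrightarrow> block_sites n x \<subseteq> block_sites (Suc n) b"
  by (cases b, cases x) (auto simp: block_sites_def subblocks_iff div_mult2_eq[symmetric] mult.commute)

text \<open>Badness is decided by the cells of the block's own sites. Membership in the generated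
  sigma-algebra is the form that \<open>prob_Int_hit_sigma\<close> requires.\<close>

lemma bad_block_event:
  "{\<omega> \<in> space P. bad_block (occupied B \<omega>) n b} \<in>
    sigma_sets (space P) ((\<lambda>i. hit (B i)) ` block_sites n b)"
proof (induction n arbitrary: b)
  case 0
  have "{\<omega> \<in> space P. bad_block (occupied B \<omega>) 0 b} = space P - hit (B b)"
    by (auto simp: occupied_def hit_def)
  also have "\<dots> \<in> sigma_sets (space P) ((\<lambda>i. hit (B i)) ` block_sites 0 b)"
    by (intro sigma_sets.Compl sigma_sets.Basic) (auto simp: block_sites_def)
  finally show ?case .
next
  case (Suc n)
  let ?G = "(\<lambda>i. hit (B i)) ` block_sites (Suc n) b"
  interpret N: sigma_algebra "space P" "sigma_sets (space P) ?G"
    by (rule sigma_algebra_sigma_sets) (auto simp: hit_def)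
  have "{\<omega> \<in> space P. bad_block (occupied B \<omega>) n x} \<in> sigma_sets (space P) ?G" if "x \<in> subblocks b" for x
    using sigma_sets_mono'[OF image_mono[OF block_sites_subblock[OF that]]] Suc.IH by blast
  then have "{\<omega> \<in> space P. \<exists>x\<in>subblocks b. \<exists>y\<in>subblocks b. x \<noteq> y \<and>
      bad_block (occupied B \<omega>) n x \<and> bad_block (occupied B \<omega>) n y} \<in> sigma_sets (space P) ?G"
    by (intro N.sets_Collect_finite_Ex N.sets_Collect_conj N.sets_Collect_const finite_subblocks)
  then show ?case by simp
qed

text \<open>There are at most 81 ordered pairs of distinct subblocks, independent of each other, so
  81 times the bound is at most squared from level to level. It starts at
  \<open>81 / 324 = 1 / 4\<close>, and \<open>2 * (n + 1) \<ge> n + 2\<close> leaves the stated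
  power.\<close>

lemma prob_bad_block_le:
  assumes disj: "disjoint_family B" and B: "\<And>i. B i \<in> sets \<nu>"
    and vac: "\<And>i. 1 - prob (hit (B i)) \<le> 1 / 324"
  shows "prob {\<omega> \<in> space P. bad_block (occupied B \<omega>) n b} \<le> (1 / 4) ^ Suc n / 81"
proof (induction n arbitrary: b)
  case 0
  have "{\<omega> \<in> space P. bad_block (occupied B \<omega>) 0 b} = space P - hit (B b)"
    by (auto simp: occupied_def hit_def)
  then show ?case using prob_compl[OF hit_in_events[OF B[of b]]] vac[of b] by simp
next
  case (Suc n)
  let ?E = "\<lambda>x. {\<omega> \<in> space P. bad_block (occupied B \<omega>) n x}"
  let ?I = "{(x, y) \<in> subblocks b \<times> subblocks b. x \<noteq> y}"
  have ev: "?E x \<in> events" for x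
    using hit_sigma_sets_in_events[OF B bad_block_event] .
  have fin: "finite ?I" by (rule finite_subset[of _ "subblocks b \<times> subblocks b"]) (auto simp: finite_subblocks)
  have "card ?I \<le> card (subblocks b \<times> subblocks b)"
    by (rule card_mono) (auto simp: finite_subblocks)
  also have "\<dots> \<le> 9 * 9" unfolding card_cartesian_product by (intro mult_le_mono card_subblocks)
  finally have card: "real (card ?I) \<le> 81" by simp
  have "{\<omega> \<in> space P. bad_block (occupied B \<omega>) (Suc n) b} = (\<Union>(x, y)\<in>?I. ?E x \<inter> ?E y)"
    by (simp only: bad_block.simps) blast
  then have "prob {\<omega> \<in> space P. bad_block (occupied B \<omega>) (Suc n) b} = prob (\<Union>(x, y)\<in>?I. ?E x \<inter> ?E y)"
    by simp
  also have "\<dots> \<le> (\<Sum>z\<in>?I. prob (case z of (x, y) \<Rightarrow> ?E x \<inter> ?E y))"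
    using ev fin by (intro finite_measure_subadditive_finite) auto
  also have "\<dots> \<le> (\<Sum>z\<in>?I. ((1 / 4) ^ Suc n / 81)\<^sup>2)"
  proof (rule sum_mono)
    fix z assume z: "z \<in> ?I"
    obtain x y where xy: "z = (x, y)" "x \<noteq> y" using z by auto
    have "prob (?E x \<inter> ?E y) = prob (?E x) * prob (?E y)"
      using prob_Int_hit_sigma[OF disj B block_sites_disjoint[OF xy(2)] bad_block_event bad_block_event] .
    also have "\<dots> \<le> ((1 / 4) ^ Suc n / 81) * ((1 / 4) ^ Suc n / 81)"
      by (intro mult_mono Suc.IH) auto
    finally show "prob (case z of (x, y) \<Rightarrow> ?E x \<inter> ?E y) \<le> ((1 / 4) ^ Suc n / 81)\<^sup>2"
      by (simp only: xy prod.case power2_eq_square)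
  qed
  also have "\<dots> = card ?I * ((1 / 4) ^ Suc n / 81)\<^sup>2" by simp
  also have "\<dots> \<le> 81 * ((1 / 4) ^ Suc n / 81)\<^sup>2" using card by (intro mult_right_mono) auto
  also have "\<dots> = (1 / 4) ^ (Suc n + Suc n) / 81" by (simp add: power2_eq_square power_add)
  also have "\<dots> \<le> (1 / 4) ^ Suc (Suc n) / 81"
    by (intro divide_right_mono power_decreasing) auto
  finally show ?case .
qed

end

text \<open>The weight in (A3) is at least 1 on \<open>{1..}\<close>. Finiteness is what makes
  \<open>prob_hit\<close> applicable to cells containing all radii from \<open>r\<close> on.\<close>

lemma emeasure_atLeast_finite:
  assumes lf: "locally_finite_pos \<mu>" and mom: "moment_condition d s \<mu>" and "s > 0" "r > 0"
  shows "emeasure \<mu> {r..} < \<infinity>"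
proof -
  have meas: "{r..1} \<in> sets \<mu>" "{1..} \<in> sets \<mu>" "{r..} \<in> sets \<mu>"
    using \<open>r > 0\<close> by (auto intro!: locally_finite_posD(4)[OF lf])
  have "emeasure \<mu> {1..} = (\<integral>\<^sup>+ \<beta>. indicator {1..} \<beta> \<partial>\<mu>)" using meas by simp
  also have "\<dots> \<le> (\<integral>\<^sup>+ \<beta>\<in>{1..}. ennreal (\<beta> powr (real d + s)) \<partial>\<mu>)"
  proof (intro nn_integral_mono)
    fix \<beta> :: real
    have "1 \<le> \<beta> powr (real d + s)" if "1 \<le> \<beta>"
      using that \<open>s > 0\<close> by (intro ge_one_powr_ge_zero) auto
    then show "indicator {1..} \<beta> \<le> ennreal (\<beta> powr (real d + s)) * indicator {1..} \<beta>"
      by (cases "1 \<le> \<beta>") simp_all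
  qed
  also have "\<dots> < \<infinity>" using mom by (simp add: moment_condition_def)
  finally have 1: "emeasure \<mu> {1..} < \<infinity>" .
  have "emeasure \<mu> {r..} \<le> emeasure \<mu> ({r..1} \<union> {1..})"
    using meas by (intro emeasure_mono) auto
  also have "\<dots> \<le> emeasure \<mu> {r..1} + emeasure \<mu> {1..}"
    using meas by (intro emeasure_subadditive) auto
  also have "\<dots> < \<infinity>" using 1 locally_finite_posD(3)[OF lf \<open>r > 0\<close>] by simp
  finally show ?thesis .
qed

lemma tail_condition_necessary:
  fixes \<xi> :: "'w \<Rightarrow> ((real ^ 'n) \<times> real) set"
  assumes lf: "locally_finite_pos \<mu>" and s: "s > 0" and lam: "lam > 0" and d: "CARD('n) \<ge> 2"
    and ppp: "poisson_point_process P (boolean_intensity lam \<mu>) \<xi>"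
    and fin: "radius_moment P \<xi> s < \<infinity>"
  shows "tail_condition CARD('n) \<mu>"
proof (rule ccontr)
  assume "\<not> tail_condition CARD('n) \<mu>"
  let ?d = "CARD('n)"
  interpret poisson_point_process P "boolean_intensity lam \<mu>" \<xi> by fact
  have mom: "moment_condition ?d s \<mu>" by (rule moment_condition_necessary) fact+
  obtain k1 k2 :: 'n where k: "k1 \<noteq> k2"
    using d by (metis (full_types) UNIV_I card_2_iff' card_le_Suc0_iff_eq finite not_less_eq_eq numeral_2_eq_2)
  \<comment> \<open>Chosen so that \<open>r ^ d * \<mu> {r..} \<ge> N\<close> gives each cell of
    side \<open>r / (4 * d)\<close> a mean of at least \<open>ln 324\<close>, hence vacancy
    probability at most \<open>1 / 324\<close>.\<close>
  define N where "N = ln 324 * (4 * ?d) ^ ?d / lam"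
  have "(SUP r\<in>{0<..}. ennreal (r ^ ?d) * emeasure \<mu> {r..}) = \<infinity>"
    using \<open>\<not> tail_condition ?d \<mu>\<close> by (simp add: tail_condition_def less_top[symmetric]) blast
  then have "ennreal N < (SUP r\<in>{0<..}. ennreal (r ^ ?d) * emeasure \<mu> {r..})" by (simp only: ennreal_less_top infinity_ennreal_def)
  then obtain r where r: "r > 0" "ennreal N < ennreal (r ^ ?d) * emeasure \<mu> {r..}"
    by (auto simp: less_SUP_iff)
  note tail_fin = emeasure_atLeast_finite[OF lf mom s r(1)]
  have "ennreal N < ennreal (r ^ ?d * measure \<mu> {r..})"
    using r tail_fin by (simp add: ennreal_mult emeasure_eq_ennreal_measure less_top[symmetric])
  then have N: "N \<le> r ^ ?d * measure \<mu> {r..}" by (simp add: ennreal_less_iff lam N_def less_imp_le)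
  define B where "B = slice_cell k1 k2 (r / (4 * ?d)) r"
  have site_inj: "slice_site k1 k2 x = slice_site k1 k2 y \<Longrightarrow> x = y" for x y
    using k by (auto simp: slice_site_def vec_eq_iff prod_eq_iff dest: spec[of _ k1] spec[of _ k2])
  have eps: "r / (4 * ?d) > 0" using r by simp
  have disj: "disjoint_family B"
    unfolding disjoint_family_on_def B_def slice_cell_def
    using site_inj cube_unique[OF eps] by fast
  have sub: "{r..} \<subseteq> {0<..}" using r by auto
  have B: "B x \<in> sets (boolean_intensity lam \<mu>)" "emeasure (boolean_intensity lam \<mu>) (B x) < \<infinity>"
    "measure (boolean_intensity lam \<mu>) (B x) = lam * (r / (4 * ?d)) ^ ?d * measure \<mu> {r..}" for x
    using emeasure_cube_times[OF lf _ sub tail_fin eps lam, of "slice_site k1 k2 x"]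
    by (simp_all add: B_def slice_cell_def)
  have "ln 324 \<le> lam * (r / (4 * ?d)) ^ ?d * measure \<mu> {r..}"
  proof -
    have "ln 324 = lam / (4 * ?d) ^ ?d * N" using lam by (simp add: N_def)
    also have "\<dots> \<le> lam / (4 * ?d) ^ ?d * (r ^ ?d * measure \<mu> {r..})"
      using lam N by (intro mult_left_mono) auto
    finally show ?thesis by (simp add: power_divide)
  qed
  then have "exp (- measure (boolean_intensity lam \<mu>) (B x)) \<le> exp (- ln 324)" for x by (simp add: B(3))
  then have vac: "1 - prob (hit (B x)) \<le> 1 / 324" for x
    using prob_hit[OF B(1,2)] by (simp add: exp_minus inverse_eq_divide)
  let ?E = "\<lambda>n. {\<omega> \<in> space P. bad_block (occupied B \<omega>) n (0, 0)}"
  have ev: "?E n \<in> events" for n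
    using hit_sigma_sets_in_events[OF B(1) bad_block_event] .
  \<comment> \<open>The bad probabilities of the origin blocks at levels up to \<open>n + 1\<close>
    sum to at most \<open>(4 / 3) / 324\<close>, so with probability at least \<open>1 / 2\<close>
    all are good. Then \<open>M\<close> is at least a multiple of \<open>3 ^ n\<close>, and as
    \<open>n\<close> is arbitrary, no finite moment is possible.\<close>
  have bound: "(r / (4 * ?d) * (2 * 3 ^ n)) powr s / 2 \<le> enn2real (radius_moment P \<xi> s)" for n
  proof -
    let ?U = "\<Union>k\<in>{..Suc n}. ?E k" and ?L = "(r / (4 * ?d) * (2 * 3 ^ n)) powr s"
    have "prob ?U \<le> (\<Sum>k\<le>Suc n. prob (?E k))"
      using ev by (intro finite_measure_subadditive_finite) auto
    also have "\<dots> \<le> (\<Sum>k\<le>Suc n. (1 / 4) ^ Suc k / 81)"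
      by (intro sum_mono prob_bad_block_le disj B vac)
    also have "\<dots> = (\<Sum>k\<le>Suc n. (1 / 4) ^ k) / 324"
      unfolding sum_divide_distrib by (intro sum.cong) auto
    also have "(\<Sum>k\<le>Suc n. (1 / 4 :: real) ^ k) \<le> 4 / 3"
      by (subst sum_gp0) (simp add: field_simps)
    finally have "prob ?U \<le> 1 / 2" by simp
    have U: "?U \<in> events" using ev by auto
    define G where "G = space P - ?U"
    have G: "G \<in> events" "1 / 2 \<le> prob G"
      using U \<open>prob ?U \<le> 1 / 2\<close> by (auto simp: G_def prob_compl)
    have "ennreal (?L / 2) \<le> ennreal (?L * prob G)"
      using G(2) mult_left_mono[OF G(2), of ?L] by (intro ennreal_leI) simp
    also have "\<dots> = ennreal ?L * emeasure P G" by (simp add: emeasure_eq_measure ennreal_mult)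
    also have "\<dots> = (\<integral>\<^sup>+ \<omega>. ennreal ?L * indicator G \<omega> \<partial>P)"
      using G by (simp add: nn_integral_cmult_indicator)
    also have "\<dots> \<le> radius_moment P \<xi> s"
      unfolding radius_moment_def
    proof (intro nn_integral_mono)
      fix \<omega>
      show "ennreal ?L * indicator G \<omega> \<le> ennreal_powr (component_radius (\<xi> \<omega>)) s"
      proof (cases "\<omega> \<in> G")
        case True
        then have "\<not> bad_block {x. \<xi> \<omega> \<inter> slice_cell k1 k2 (r / (4 * ?d)) r x \<noteq> {}} k (0, 0)" if "k \<le> Suc n" for k
          using that unfolding G_def occupied_def B_def by blast
        from component_radius_ge_of_good_blocks[OF r(1) this] True
        show ?thesis using r s by (intro order_trans[OF _ ennreal_powr_ge[of "r / (4 * ?d) * (2 * 3 ^ n)"]]) auto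
      qed simp
    qed
    finally show ?thesis
      using fin by (cases "radius_moment P \<xi> s") auto
  qed
  define M where "M = (2 * enn2real (radius_moment P \<xi> s)) powr (1 / s)"
  have "r / (4 * ?d) * (2 * 3 ^ n) \<le> M" for n
  proof -
    have "((r / (4 * ?d) * (2 * 3 ^ n)) powr s) powr (1 / s) \<le> M"
      unfolding M_def using bound[of n] s by (intro powr_mono2) auto
    then show ?thesis using s r by (simp add: powr_powr)
  qed
  then have "3 ^ n \<le> M / (r / (4 * ?d) * 2)" for n :: nat
    using r by (simp add: field_simps)
  then show False using real_arch_pow[of 3 "M / (r / (4 * ?d) * 2)"] by (auto simp: not_less[symmetric])
qed

subsection \<open>Chains of balls and crossings\<close>

text \<open>Chains of overlapping balls. The closure is reflexive even at \<open>p\<close> outside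
  \<open>Y\<close>, so membership of the end points is stated separately where it matters.\<close>

definition linked :: "((real ^ 'n) \<times> real) set \<Rightarrow> (real ^ 'n) \<times> real \<Rightarrow> (real ^ 'n) \<times> real \<Rightarrow> bool" where
  "linked Y = (\<lambda>p q. p \<in> Y \<and> q \<in> Y \<and> dist (fst p) (fst q) < snd p + snd q)\<^sup>*\<^sup>*"

lemma linked_refl: "linked Y p p"
  by (simp add: linked_def)

lemma linked_step:
  "linked Y p q \<Longrightarrow> q \<in> Y \<Longrightarrow> r \<in> Y \<Longrightarrow> dist (fst q) (fst r) < snd q + snd r \<Longrightarrow> linked Y p r"
  unfolding linked_def by (rule rtranclp.rtrancl_into_rtrancl) auto

lemma linked_sym: "linked Y p q \<Longrightarrow> linked Y q p"
  unfolding linked_def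
  by (rule sympD[OF symp_rtranclp]) (auto intro!: sympI simp: dist_commute add.commute)

lemma linked_mono: "linked Y p q \<Longrightarrow> Y \<subseteq> Z \<Longrightarrow> linked Z p q"
  unfolding linked_def by (rule rtranclp_mono[THEN predicate2D, rotated]) auto

lemma linked_induct [consumes 1, case_names base step]:
  assumes "linked Y p q" "Q p"
    and "\<And>q r. linked Y p q \<Longrightarrow> Q q \<Longrightarrow> q \<in> Y \<Longrightarrow> r \<in> Y \<Longrightarrow> dist (fst q) (fst r) < snd q + snd r \<Longrightarrow> Q r"
  shows "Q q"
  using assms(1) unfolding linked_def
  by (induction rule: rtranclp_induct) (use assms(2,3) in \<open>auto simp: linked_def\<close>)

lemma infnorm_triangle_diff: "infnorm (x - z) \<le> infnorm (x - y) + infnorm (y - z)"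
  using infnorm_triangle[of "x - y" "y - z"] by simp

lemma infnorm_diff_le_dist: "infnorm (x - y) \<le> dist x y"
  unfolding dist_norm by (rule infnorm_le_norm)

definition lattice_point :: "real \<Rightarrow> int ^ 'n \<Rightarrow> real ^ 'n" where
  "lattice_point a v = (\<chi> i. a * of_int (v $ i))"

definition offsets :: "(int ^ 'n) set" where
  "offsets = {u. \<forall>i. \<bar>u $ i\<bar> \<le> 101}"

definition refine :: "int ^ 'n \<Rightarrow> int ^ 'n \<Rightarrow> int ^ 'n" where
  "refine z u = (\<chi> i. 10 * z $ i + u $ i)"

lemma infnorm_cube_lattice_point: "a > 0 \<Longrightarrow> c \<in> cube a v \<Longrightarrow> infnorm (c - lattice_point a v) \<le> a"
  unfolding infnorm_vec_le_iff
proof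
  fix i assume "a > 0" "c \<in> cube a v"
  then have "a * v $ i \<le> c $ i" "c $ i < a * v $ i + a" by (auto simp: cube_def algebra_simps)
  then show "\<bar>(c - lattice_point a v) $ i\<bar> \<le> a" by (simp add: lattice_point_def)
qed

lemma ex_offset_cube:
  fixes c :: "real ^ 'n"
  assumes a: "a > 0" and c: "infnorm (c - lattice_point (10 * a) z) \<le> 100 * a"
  shows "\<exists>u\<in>offsets. c \<in> cube a (refine z u)"
proof -
  define v where "v = (\<chi> i. \<lfloor>c $ i / a\<rfloor>)"
  define u where "u = v - (\<chi> i. 10 * z $ i)"
  have cv: "c \<in> cube a v" by (simp add: mem_cube_iff_floor[OF a] v_def)
  have "\<bar>u $ i\<bar> \<le> 101" for i
  proof -
    have 1: "a * v $ i \<le> c $ i" "c $ i < a * v $ i + a" using cv by (auto simp: cube_def algebra_simps)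
    have 2: "\<bar>c $ i - 10 * a * z $ i\<bar> \<le> 100 * a"
      using c by (auto simp: infnorm_vec_le_iff lattice_point_def)
    have "\<bar>a * v $ i - 10 * a * z $ i\<bar> \<le> 101 * a" using 1 2 by linarith
    also have "a * v $ i - 10 * a * z $ i = a * (u $ i)" by (simp add: u_def algebra_simps)
    finally have "a * \<bar>real_of_int (u $ i)\<bar> \<le> a * 101" using a by (simp add: abs_mult mult.commute)
    then show ?thesis using a by simp
  qed
  moreover have "refine z u = v" by (simp add: refine_def u_def vec_eq_iff)
  ultimately show ?thesis using cv by (intro bexI[of _ u]) (auto simp: offsets_def)
qed

text \<open>
  \<open>W\<close> holds the occupied cells \<open>(k, v)\<close>, with \<open>k\<close> the scale and \<open>v\<close> the position. A certificate at scale
  \<open>n\<close> only involves cells within \<open>12 * 10 ^ n\<close> of its position, so positions more than 24 apart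
  depend on disjoint sets of cells. Offsets go up to 101 because crossings are followed up to sup norm
  distance 100 and rounding to a lattice point costs 1.
\<close>

fun certificate :: "(nat \<times> (int ^ 'n)) set \<Rightarrow> nat \<Rightarrow> int ^ 'n \<Rightarrow> bool" where
  "certificate W 0 z \<longleftrightarrow> False"
| "certificate W (Suc n) z \<longleftrightarrow> (\<exists>u\<in>offsets. (n, refine z u) \<in> W) \<or>
    (\<exists>u\<in>offsets. \<exists>u'\<in>offsets. (\<exists>i. 24 < \<bar>u $ i - u' $ i\<bar>) \<and>
      certificate W n (refine z u) \<and> certificate W n (refine z u'))"

text \<open>The cut-off \<open>\<delta>\<close> starts the induction: for \<open>n = 0\<close> the
  radii would have to lie in the empty range from \<open>\<delta>\<close> to
  \<open>\<delta>\<close>.\<close>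

definition crossing :: "((real ^ 'n) \<times> real) set \<Rightarrow> real \<Rightarrow> nat \<Rightarrow> int ^ 'n \<Rightarrow> bool" where
  "crossing X \<delta> n z \<longleftrightarrow> (let a = \<delta> * 10 ^ n; Y = {p \<in> X. \<delta> \<le> snd p \<and> snd p < a} in
    \<exists>p q. p \<in> Y \<and> q \<in> Y \<and> linked Y p q \<and> infnorm (fst p - lattice_point a z) \<le> 2 * a \<and>
      8 * a \<le> infnorm (fst q - lattice_point a z))"

text \<open>A crossing at scale \<open>10 * a\<close> either meets a ball of radius at least \<open>a\<close> or contains two
  crossings at scale \<open>a\<close>, one near its start and one, read backwards, near its end.\<close>

lemma crossing_imp_certificate:
  fixes X :: "((real ^ 'n) \<times> real) set"
  assumes \<delta>: "\<delta> > 0"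
  shows "crossing X \<delta> n z \<Longrightarrow> certificate {(k, v). X \<inter> cell (\<delta> * 10 ^ k) v \<noteq> {}} n z"
proof (induction n arbitrary: z)
  case 0
  then show ?case by (auto simp: crossing_def simp del: split_paired_Ex)
next
  case (Suc n)
  define a where "a = \<delta> * 10 ^ n"
  have a: "a > 0" using \<delta> by (simp add: a_def)
  let ?W = "{(k, v). X \<inter> cell (\<delta> * 10 ^ k) v \<noteq> {}}"
  let ?z = "lattice_point (10 * a) z"
  define Y where "Y = {p \<in> X. \<delta> \<le> snd p \<and> snd p < a}"
  define Y' where "Y' = {p \<in> X. \<delta> \<le> snd p \<and> snd p < 10 * a}"
  have Suc_a: "\<delta> * 10 ^ Suc n = 10 * a" by (simp add: a_def)
  obtain p q where pq: "p \<in> Y'" "linked Y' p q" "infnorm (fst p - ?z) \<le> 20 * a" "80 * a \<le> infnorm (fst q - ?z)"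
    using Suc.prems unfolding crossing_def Suc_a Let_def Y'_def by auto
  show ?case
  \<comment> \<open>A large radius near \<open>z\<close> yields an occupied cell of scale
    \<open>n\<close>. Otherwise all radii within distance \<open>100 * a\<close> are below
    \<open>a\<close>, and two smaller crossings must be found.\<close>
  proof (cases "\<exists>r\<in>Y'. a \<le> snd r \<and> infnorm (fst r - ?z) \<le> 100 * a")
    case True
    then obtain r where r: "r \<in> Y'" "a \<le> snd r" "infnorm (fst r - ?z) \<le> 100 * a" by blast
    obtain u where u: "u \<in> offsets" "fst r \<in> cube a (refine z u)" using ex_offset_cube[OF a r(3)] by blast
    have "r \<in> X \<inter> cell a (refine z u)" using r u by (cases r) (auto simp: Y'_def cell_def)
    then have "(n, refine z u) \<in> ?W" unfolding a_def by blast
    then show ?thesis using u(1) by auto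
  next
    case False
    then have small: "r \<in> Y" if "r \<in> Y'" "infnorm (fst r - ?z) \<le> 100 * a" for r
    proof -
      have "\<not> a \<le> snd r" using False that by blast
      then show ?thesis using that(1) by (simp add: Y_def Y'_def)
    qed
    \<comment> \<open>Follow the chain until it first reaches distance \<open>80 * a\<close>. A step
      from a radius below \<open>a\<close> to one below \<open>10 * a\<close> moves the centre by
      less than \<open>11 * a\<close>, so it ends within \<open>100 * a\<close>, where radii are
      again below \<open>a\<close>.\<close>
    have "(q \<in> Y \<and> linked Y p q \<and> infnorm (fst q - ?z) < 80 * a) \<or>
        (\<exists>q'\<in>Y. linked Y p q' \<and> 80 * a \<le> infnorm (fst q' - ?z) \<and> infnorm (fst q' - ?z) \<le> 100 * a)"
      using pq(2)
    proof (induction rule: linked_induct)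
      case base
      then show ?case using small[OF pq(1)] pq(3) a by (auto intro: linked_refl)
    next
      case (step q r)
      show ?case
      proof (cases "q \<in> Y \<and> linked Y p q \<and> infnorm (fst q - ?z) < 80 * a")
        case True
        have "infnorm (fst r - ?z) \<le> dist (fst q) (fst r) + infnorm (fst q - ?z)"
          using infnorm_triangle_diff[of "fst r" ?z "fst q"] infnorm_diff_le_dist[of "fst r" "fst q"]
          by (simp add: dist_commute)
        also have "\<dots> < a + 10 * a + 80 * a"
          using step True by (auto simp: Y_def Y'_def)
        finally have *: "infnorm (fst r - ?z) \<le> 100 * a" using a by simp
        then have "r \<in> Y" using small step by blast
        moreover from this have "linked Y p r" using True step by (intro linked_step[of Y p q r]) auto
        ultimately show ?thesis using * by force
      next
        case False
        then show ?thesis using step.IH by blast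
      qed
    qed
    then obtain q' where q': "q' \<in> Y" "linked Y p q'" "80 * a \<le> infnorm (fst q' - ?z)" "infnorm (fst q' - ?z) \<le> 100 * a"
      using pq(4) by force
    have pY: "p \<in> Y" using small pq a by simp
    obtain u where u: "u \<in> offsets" "fst p \<in> cube a (refine z u)"
      using ex_offset_cube[OF a, of "fst p" z] pq(3) a by auto
    obtain u' where u': "u' \<in> offsets" "fst q' \<in> cube a (refine z u')"
      using ex_offset_cube[OF a q'(4)] by blast
    let ?w = "lattice_point a (refine z u)" and ?w' = "lattice_point a (refine z u')"
    have w: "infnorm (fst p - ?w) \<le> a" "infnorm (fst q' - ?w') \<le> a"
      using infnorm_cube_lattice_point[OF a] u(2) u'(2) by blast+
    \<comment> \<open>The end points are \<open>60 * a\<close> apart, and each rounding to a lattice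
      point costs at most \<open>a\<close>. The remaining 59 exceeds the 8 needed for a crossing,
      and 58 exceeds the 24 needed for separated offsets.\<close>
    have far: "60 * a \<le> infnorm (fst q' - fst p)"
      using infnorm_triangle_diff[of "fst q'" ?z "fst p"] pq(3) q'(3) by linarith
    have "59 * a \<le> infnorm (fst q' - ?w)"
      using infnorm_triangle_diff[of "fst q'" "fst p" ?w] infnorm_sub[of "fst p" ?w] far w(1) by linarith
    then have "crossing X \<delta> n (refine z u)"
      using pY q' w(1) a unfolding crossing_def a_def[symmetric] Let_def Y_def[symmetric]
      by (intro exI[of _ p] exI[of _ q']) auto
    moreover have "59 * a \<le> infnorm (fst p - ?w')"
      using infnorm_triangle_diff[of "fst q'" "fst p" ?w'] infnorm_sub[of "fst p" ?w'] far w(2) by linarith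
    then have "crossing X \<delta> n (refine z u')"
      using pY q' w(2) a unfolding crossing_def a_def[symmetric] Let_def Y_def[symmetric]
      by (intro exI[of _ q'] exI[of _ p]) (auto intro: linked_sym)
    moreover have "\<exists>i. 24 < \<bar>u $ i - u' $ i\<bar>"
    proof -
      have "58 * a \<le> infnorm (?w' - ?w)"
        using infnorm_triangle_diff[of "fst q'" ?w ?w'] w(2) \<open>59 * a \<le> infnorm (fst q' - ?w)\<close> by linarith
      then obtain i where "58 * a \<le> \<bar>(?w' - ?w) $ i\<bar>" using infnorm_vec_attained[of "?w' - ?w"] by auto
      also have "\<dots> = \<bar>a * real_of_int (u' $ i - u $ i)\<bar>" by (simp add: lattice_point_def refine_def algebra_simps)
      also have "\<dots> = a * real_of_int \<bar>u $ i - u' $ i\<bar>" using a by (simp add: abs_mult abs_minus_commute)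
      finally have "58 \<le> real_of_int \<bar>u $ i - u' $ i\<bar>" using a by (simp add: mult.commute)
      then show ?thesis by (intro exI[of _ i]) linarith
    qed
    ultimately show ?thesis
      unfolding certificate.simps by (intro disjI2 bexI[OF _ u(1)] bexI[OF _ u'(1)] conjI Suc.IH)
  qed
qed

text \<open>Positions are compared in units of the smallest scale. The constant 12 reproduces
  itself: an offset of at most 101 plus the range 12 one scale down gives 113, less than
  \<open>12 * 10\<close>.\<close>

definition certificate_cells :: "nat \<Rightarrow> int ^ 'n \<Rightarrow> (nat \<times> (int ^ 'n)) set" where
  "certificate_cells n z = {(j, v). j < n \<and> (\<forall>i. \<bar>10 ^ j * v $ i - 10 ^ n * z $ i\<bar> \<le> 12 * 10 ^ n)}"

lemma offset_in_certificate_cells: "u \<in> offsets \<Longrightarrow> (n, refine z u) \<in> certificate_cells (Suc n) z"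
proof -
  assume u: "u \<in> offsets"
  have "\<bar>10 ^ n * refine z u $ i - 10 ^ Suc n * z $ i\<bar> \<le> 12 * 10 ^ Suc n" for i
  proof -
    have "\<bar>10 ^ n * refine z u $ i - 10 ^ Suc n * z $ i\<bar> = 10 ^ n * \<bar>u $ i\<bar>"
      by (simp add: refine_def algebra_simps abs_mult)
    also have "\<dots> \<le> 10 ^ n * 120" using u by (intro mult_left_mono) (auto simp: offsets_def intro: order_trans)
    finally show ?thesis by simp
  qed
  then show ?thesis by (simp add: certificate_cells_def)
qed

lemma certificate_cells_refine:
  assumes u: "u \<in> offsets"
  shows "certificate_cells n (refine z u) \<subseteq> certificate_cells (Suc n) z"
proof (clarsimp simp: certificate_cells_def)
  fix j v i assume j: "j < n" and v: "\<forall>i. \<bar>10 ^ j * v $ i - 10 ^ n * refine z u $ i\<bar> \<le> 12 * 10 ^ n"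
  have 1: "\<bar>10 ^ j * v $ i - 10 ^ n * refine z u $ i\<bar> \<le> 12 * 10 ^ n" using v by blast
  have 2: "10 ^ n * refine z u $ i - 10 * 10 ^ n * z $ i = 10 ^ n * (u $ i)"
    by (simp add: refine_def algebra_simps)
  have "\<bar>10 ^ n * (u $ i)\<bar> = 10 ^ n * \<bar>u $ i\<bar>" by (simp add: abs_mult)
  also have "\<dots> \<le> 10 ^ n * 101" using u by (intro mult_left_mono) (auto simp: offsets_def)
  finally show "\<bar>10 ^ j * v $ i - 10 * 10 ^ n * z $ i\<bar> \<le> 120 * 10 ^ n"
    using 1 2 by linarith
qed

lemma certificate_cells_disjoint:
  assumes "24 < \<bar>u $ i - u' $ i\<bar>"
  shows "certificate_cells n (refine z u) \<inter> certificate_cells n (refine z u') = {}"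
proof (rule ccontr)
  assume "\<not> ?thesis"
  then obtain j v where "\<bar>10 ^ j * v $ i - 10 ^ n * refine z u $ i\<bar> \<le> 12 * 10 ^ n"
    "\<bar>10 ^ j * v $ i - 10 ^ n * refine z u' $ i\<bar> \<le> 12 * 10 ^ n"
    by (fastforce simp: certificate_cells_def)
  then have "\<bar>10 ^ n * refine z u $ i - 10 ^ n * refine z u' $ i\<bar> \<le> 10 ^ n * 24" by linarith
  moreover have "10 ^ n * refine z u $ i - 10 ^ n * refine z u' $ i = 10 ^ n * (u $ i - u' $ i)"
    by (simp add: refine_def algebra_simps)
  ultimately have "10 ^ n * \<bar>u $ i - u' $ i\<bar> \<le> 10 ^ n * 24" by (simp add: abs_mult)
  then show False using assms by simp
qed

lemma finite_offsets: "finite offsets"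
proof -
  have "offsets \<subseteq> vec_lambda ` (UNIV \<rightarrow>\<^sub>E {-101..101})"
  proof
    fix u :: "int ^ 'n" assume "u \<in> offsets"
    then have "(\<lambda>i. u $ i) \<in> UNIV \<rightarrow>\<^sub>E {-101..101}" by (auto simp: offsets_def abs_le_iff) (smt (verit))
    then show "u \<in> vec_lambda ` (UNIV \<rightarrow>\<^sub>E {-101..101})" by (metis image_eqI vec_nth_inverse)
  qed
  then show ?thesis by (rule finite_subset) (intro finite_imageI finite_PiE; simp)
qed

text \<open>The balls linked to one that covers the origin and the remaining balls have disjoint
  open unions, since any ball meeting a linked ball is linked. Connectedness puts the component into
  the first union.\<close>

lemma origin_component_linked:
  assumes "x \<in> origin_component X"
  obtains p q where "p \<in> X" "q \<in> X" "linked X p q" "0 \<in> ball (fst p) (snd p)" "x \<in> ball (fst q) (snd q)"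
proof -
  have "0 \<in> covered_set X" using assms connected_component_in by (fastforce simp: origin_component_def)
  then obtain p where p: "p \<in> X" "0 \<in> ball (fst p) (snd p)" by (auto simp: covered_set_def)
  let ?U = "\<Union>q\<in>{q \<in> X. linked X p q}. ball (fst q) (snd q)"
  let ?V = "\<Union>q\<in>{q \<in> X. \<not> linked X p q}. ball (fst q) (snd q)"
  have disj: "?U \<inter> ?V = {}"
  proof (rule ccontr)
    assume "?U \<inter> ?V \<noteq> {}"
    then obtain y q r where qr: "q \<in> X" "linked X p q" "y \<in> ball (fst q) (snd q)"
      "r \<in> X" "\<not> linked X p r" "y \<in> ball (fst r) (snd r)" by blast
    have "dist (fst q) (fst r) < snd q + snd r"
      using qr(3,6) dist_triangle[of "fst q" "fst r" y] by (simp add: dist_commute)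
    then show False using linked_step qr by blast
  qed
  have "covered_set X \<subseteq> ?U \<union> ?V" by (fastforce simp: covered_set_def)
  then have "origin_component X \<subseteq> ?U \<union> ?V"
    unfolding origin_component_def using connected_component_subset by blast
  moreover have "connected (origin_component X)" unfolding origin_component_def by (rule connected_connected_component)
  moreover have "open ?U" "open ?V" by auto
  moreover have "0 \<in> ?U \<inter> origin_component X"
    using p \<open>0 \<in> covered_set X\<close> linked_refl[of X p]
    by (intro IntI UN_I[of p]) (auto simp: origin_component_def)
  ultimately have "?V \<inter> origin_component X = {}"
    using disj connectedD[of "origin_component X" ?U ?V] by blast
  then have "x \<in> ?U" using assms \<open>origin_component X \<subseteq> ?U \<union> ?V\<close> by blast
  then show ?thesis using that p by blast
qed

text \<open>A chain is finite, so its radii have a positive minimum. The bound depends on the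
  chain.\<close>

lemma linked_bounded_below:
  assumes "linked X p q" "p \<in> X" "\<And>p. p \<in> X \<Longrightarrow> snd p > 0"
  shows "\<exists>\<delta>>0. \<delta> \<le> snd p \<and> \<delta> \<le> snd q \<and> linked {y \<in> X. \<delta> \<le> snd y} p q"
  using assms(1)
proof (induction rule: linked_induct)
  case base
  then show ?case using assms(2,3) by (intro exI[of _ "snd p"]) (auto intro: linked_refl)
next
  case (step q r)
  then obtain \<delta> where \<delta>: "\<delta> > 0" "\<delta> \<le> snd p" "\<delta> \<le> snd q" "linked {y \<in> X. \<delta> \<le> snd y} p q" by blast
  let ?\<delta> = "min \<delta> (snd r)"
  have "linked {y \<in> X. ?\<delta> \<le> snd y} p q" by (rule linked_mono[OF \<delta>(4)]) auto
  then have "linked {y \<in> X. ?\<delta> \<le> snd y} p r" by (rule linked_step) (use step \<delta> in auto)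
  then show ?case using \<delta> step assms(3) by (intro exI[of _ ?\<delta>]) auto
qed

text \<open>When no ball of radius at least \<open>A\<close> has its centre within ten radii of the
  origin, a chain from the origin to \<open>x\<close> must leave distance \<open>8 * A\<close> using
  only radii below \<open>A\<close>. The chain is preserved by every cut-off below its smallest
  radius, hence the quantifier over small \<open>\<delta>\<close>.\<close>

lemma crossing_of_far_component:
  fixes X :: "((real ^ 'n) \<times> real) set"
  assumes x: "x \<in> origin_component X" "10 * A \<le> infnorm x" and A: "A > 0"
    and pos: "\<And>p. p \<in> X \<Longrightarrow> snd p > 0"
    and small: "\<And>p. p \<in> X \<Longrightarrow> A \<le> snd p \<Longrightarrow> 10 * snd p < infnorm (fst p)"
  shows "\<exists>\<delta>\<^sub>0>0. \<forall>\<delta> n. 0 < \<delta> \<and> \<delta> \<le> \<delta>\<^sub>0 \<and> \<delta> * 10 ^ n = A \<longrightarrow> crossing X \<delta> n 0"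
proof -
  obtain p q where pq: "p \<in> X" "q \<in> X" "linked X p q" "0 \<in> ball (fst p) (snd p)" "x \<in> ball (fst q) (snd q)"
    using origin_component_linked[OF x(1)] .
  obtain \<delta>0 where \<delta>0: "\<delta>0 > 0" "\<delta>0 \<le> snd p" "\<delta>0 \<le> snd q" "linked {y \<in> X. \<delta>0 \<le> snd y} p q"
    using linked_bounded_below[OF pq(3,1) pos] by blast
  have "crossing X \<delta> n 0" if \<delta>: "0 < \<delta>" "\<delta> \<le> \<delta>0" "\<delta> * 10 ^ n = A" for \<delta> n
  proof (rule ccontr)
    assume no: "\<not> crossing X \<delta> n 0"
    define Y where "Y = {p \<in> X. \<delta> \<le> snd p \<and> snd p < A}"
    have lat: "lattice_point A 0 = 0" by (simp add: lattice_point_def vec_eq_iff)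
    have p_norm: "infnorm (fst p) < snd p" using pq(4) infnorm_le_norm[of "fst p"] by (simp add: dist_norm)
    have "snd p < A" using small[OF pq(1)] p_norm pos[OF pq(1)] by force
    then have p: "p \<in> Y" "infnorm (fst p) < A" using p_norm pq(1) \<delta> \<delta>0 by (auto simp: Y_def)
    have near: "infnorm (fst r) < 8 * A" if "r \<in> Y" "linked Y p r" for r
    proof (rule ccontr)
      assume "\<not> infnorm (fst r) < 8 * A"
      then have "crossing X \<delta> n 0"
        using that p A unfolding crossing_def \<delta>(3) Let_def Y_def[symmetric] lat
        by (intro exI[of _ p] exI[of _ r]) auto
      with no show False ..
    qed
    have "linked {y \<in> X. \<delta> \<le> snd y} p q" by (rule linked_mono[OF \<delta>0(4)]) (use \<delta> in auto)
    then have "q \<in> Y \<and> linked Y p q"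
    proof (induction rule: linked_induct)
      case base
      then show ?case using p by (simp add: linked_refl)
    next
      case (step q r)
      have "infnorm (fst r) \<le> dist (fst q) (fst r) + infnorm (fst q)"
        using infnorm_triangle_diff[of "fst r" 0 "fst q"] infnorm_diff_le_dist[of "fst r" "fst q"]
        by (simp add: dist_commute)
      also have "\<dots> < A + snd r + 8 * A"
        using step near[of q] by (auto simp: Y_def)
      finally have *: "infnorm (fst r) < 9 * A + snd r" by simp
      \<comment> \<open>For \<open>snd r \<ge> A\<close> the assumption \<open>small\<close> would
        give \<open>10 * snd r < 9 * A + snd r\<close>, that is, \<open>snd r < A\<close>.\<close>
      have "snd r < A"
      proof (rule ccontr)
        assume "\<not> snd r < A"
        then show False using small[of r] * step by auto
      qed
      then have "r \<in> Y" using step by (auto simp: Y_def)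
      then show ?case using step linked_step by blast
    qed
    \<comment> \<open>Without a crossing, \<open>x\<close> lies within \<open>8 * A + A\<close> of
      the origin, short of \<open>10 * A\<close>.\<close>
    then have q: "infnorm (fst q) < 8 * A" "snd q < A" using near by (auto simp: Y_def)
    have "infnorm x \<le> infnorm (x - fst q) + infnorm (fst q - 0)"
      using infnorm_triangle_diff[of x 0 "fst q"] by simp
    also have "infnorm (x - fst q) \<le> dist (fst q) x" using infnorm_diff_le_dist by (simp add: dist_commute)
    finally show False using q pq(5) x(2) A by simp
  qed
  then show ?thesis using \<delta>0(1) by blast
qed

subsection \<open>Crossing probabilities\<close>

lemma refine_0 [simp]: "refine 0 u = u"
  by (simp add: refine_def vec_eq_iff)

lemma card_offsets_pos: "card (offsets :: (int ^ 'n) set) > 0"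
proof -
  have "0 \<in> (offsets :: (int ^ 'n) set)" by (simp add: offsets_def)
  then show ?thesis using finite_offsets card_gt_0_iff by blast
qed

lemma disjoint_family_cells:
  assumes "\<delta> > 0"
  shows "disjoint_family (\<lambda>(k, v). cell (\<delta> * 10 ^ k) v :: ((real ^ 'n) \<times> real) set)"
proof -
  have "(k, v) = (l, w)"
    if "(c, r) \<in> cell (\<delta> * 10 ^ k) v" "(c, r) \<in> cell (\<delta> * 10 ^ l) w"
    for k l and v w :: "int ^ 'n" and c r
  proof -
    have "r \<in> {\<delta> * 10 ^ k..<\<delta> * (10 * 10 ^ k)} \<inter> {\<delta> * 10 ^ l..<\<delta> * (10 * 10 ^ l)}"
      using that by (simp add: cell_def mult.left_commute)
    then have kl: "k = l"
      using decimal_shells_disjoint[of \<delta>] unfolding disjoint_family_on_def by blast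
    have "c \<in> cube (\<delta> * 10 ^ k) v" "c \<in> cube (\<delta> * 10 ^ k) w" using that kl by (auto simp: cell_def)
    then show ?thesis using cube_unique[of "\<delta> * 10 ^ k" c v w] assms kl by simp
  qed
  then show ?thesis unfolding disjoint_family_on_def by fast
qed

text \<open>For a partial sum \<open>S\<close> the recursion gives
  \<open>S \<le> y 0 + suminf c + S / 2\<close>, and half of \<open>S\<close> is absorbed.\<close>

lemma summable_half_recursion:
  fixes y c :: "nat \<Rightarrow> real"
  assumes c: "summable c" "\<And>n. 0 \<le> c n" and y: "\<And>n. 0 \<le> y n" "\<And>n. y (Suc n) \<le> c n + y n / 2"
  shows "summable y"
proof (rule bounded_imp_summable)
  have *: "(\<Sum>k<n. y k) \<le> 2 * (y 0 + suminf c)" for n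
  proof (induction n)
    case 0
    then show ?case using y(1)[of 0] suminf_nonneg[OF c] by simp
  next
    case (Suc n)
    have "(\<Sum>k<Suc n. y k) = y 0 + (\<Sum>k<n. y (Suc k))" by (rule sum.lessThan_Suc_shift)
    also have "\<dots> \<le> y 0 + (\<Sum>k<n. c k + y k / 2)" using y(2) by (intro add_left_mono sum_mono) auto
    also have "\<dots> = y 0 + (\<Sum>k<n. c k) + (\<Sum>k<n. y k) / 2" by (simp add: sum.distrib sum_divide_distrib)
    also have "(\<Sum>k<n. c k) \<le> suminf c" using c by (intro sum_le_suminf) auto
    finally show ?case using Suc by simp
  qed
  show "(\<Sum>k\<le>n. y k) \<le> 2 * (y 0 + suminf c)" for n using *[of "Suc n"] by (simp add: lessThan_Suc_atMost)
qed (fact y)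

text \<open>It suffices that \<open>R\<close> detects the decimal thresholds below \<open>M\<close>;
  the last one is within a factor 100. The summand 1 covers \<open>M \<le> 10 * b\<close>, and
  \<open>M = \<infinity>\<close> passes all thresholds, forcing
  \<open>R = \<infinity>\<close>.\<close>

lemma ennreal_powr_le:
  assumes b: "b > 0" and s: "s > 0"
    and le: "\<And>n. ennreal (b * 10 ^ n) < M \<Longrightarrow> ennreal ((10 powr s) ^ n) \<le> R"
  shows "ennreal_powr M s \<le> ennreal ((100 * b) powr s) * (1 + R)"
proof (cases M)
  case (real t)
  show ?thesis
  proof (cases "t \<le> 10 * b")
    case True
    then have "t powr s \<le> (100 * b) powr s" using b s real by (intro powr_mono2) auto
    then have "ennreal_powr M s \<le> ennreal ((100 * b) powr s) * 1"
      using real by (simp add: ennreal_powr_def ennreal_leI)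
    also have "\<dots> \<le> ennreal ((100 * b) powr s) * (1 + R)" by (intro mult_left_mono) auto
    finally show ?thesis .
  next
    case False
    then have "t / b \<ge> 1" using b by simp
    then obtain k where k: "10 ^ k \<le> t / b" "t / b < 10 * 10 ^ k" using ex_decimal_shell[of "t / b"] by auto
    \<comment> \<open>The scale \<open>k\<close> only satisfies \<open>b * 10 ^ k \<le> t\<close>;
      going back to \<open>k - 1\<close> gives the strict inequality that \<open>le\<close>
      demands.\<close>
    have "k \<noteq> 0"
    proof
      assume "k = 0"
      then show False using k(2) False b by (simp add: field_simps)
    qed
    then obtain n where n: "k = Suc n" by (cases k) auto
    have 1: "b * 10 ^ n < t"
    proof -
      have "b * 10 ^ n < b * 10 ^ Suc n" using b by simp
      also have "\<dots> \<le> t" using k(1) b n by (simp add: field_simps)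
      finally show ?thesis .
    qed
    have 2: "t \<le> 100 * b * 10 ^ n" using k(2) b n by (simp add: field_simps)
    have "ennreal_powr M s = ennreal (t powr s)" using real by (simp add: ennreal_powr_def)
    also have "\<dots> \<le> ennreal ((100 * b * 10 ^ n) powr s)"
      using 2 real s by (intro ennreal_leI powr_mono2) auto
    also have "(100 * b * 10 ^ n) powr s = (100 * b) powr s * (10 powr s) ^ n"
      using b by (simp add: powr_mult powr_powr mult.commute flip: powr_realpow)
    also have "ennreal \<dots> = ennreal ((100 * b) powr s) * ennreal ((10 powr s) ^ n)"
      by (simp add: ennreal_mult)
    also have "\<dots> \<le> ennreal ((100 * b) powr s) * (1 + R)"
      using le[of n] 1 real b by (intro mult_left_mono) (auto simp: ennreal_less_iff intro: add_increasing)
    finally show ?thesis .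
  qed
next
  case top
  have q: "10 powr s > 1" using s by simp
  have "R = top"
  proof (rule ccontr)
    assume "R \<noteq> top"
    then obtain r where r: "R = ennreal r" "r \<ge> 0" by (cases R) auto
    obtain n where "r < (10 powr s) ^ n" using real_arch_pow[OF q] by blast
    moreover have "(10 powr s) ^ n \<le> r" using le[of n] top r by simp
    ultimately show False by simp
  qed
  then show ?thesis using b by (simp add: ennreal_mult_top)
qed

context poisson_point_process
begin

lemma certificate_event:
  "{\<omega> \<in> space P. certificate (occupied C \<omega>) n z} \<in>
    sigma_sets (space P) ((\<lambda>i. hit (C i)) ` certificate_cells n z)"
proof (induction n arbitrary: z)
  case 0
  then show ?case by (simp add: sigma_sets.Empty)
next
  case (Suc n)
  let ?G = "(\<lambda>i. hit (C i)) ` certificate_cells (Suc n) z"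
  interpret N: sigma_algebra "space P" "sigma_sets (space P) ?G"
    by (rule sigma_algebra_sigma_sets) (auto simp: hit_def)
  have 1: "{\<omega> \<in> space P. (n, refine z u) \<in> occupied C \<omega>} \<in> sigma_sets (space P) ?G" if "u \<in> offsets" for u
  proof -
    have "{\<omega> \<in> space P. (n, refine z u) \<in> occupied C \<omega>} = hit (C (n, refine z u))"
      by (auto simp: occupied_def hit_def)
    then show ?thesis using offset_in_certificate_cells[OF that] by (auto intro: sigma_sets.Basic)
  qed
  have 2: "{\<omega> \<in> space P. certificate (occupied C \<omega>) n (refine z u)} \<in> sigma_sets (space P) ?G" if "u \<in> offsets" for u
    using sigma_sets_mono'[OF image_mono[OF certificate_cells_refine[OF that]]] Suc.IH by blast
  show ?case unfolding certificate.simps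
    by (intro N.sets_Collect_disj N.sets_Collect_finite_Ex N.sets_Collect_conj N.sets_Collect_const finite_offsets 1 2)
qed

text \<open>Union bound over the offsets for an occupied cell, and over at most the square of their
  number for pairs of certificates, which are independent because separated offsets use disjoint
  cells.\<close>

lemma prob_certificate_le:
  fixes C :: "nat \<times> (int ^ 'n) \<Rightarrow> 'b set" and f g :: "nat \<Rightarrow> real"
  assumes disj: "disjoint_family C" and C: "\<And>i. C i \<in> sets \<nu>"
    and g: "\<And>k v. prob (hit (C (k, v))) \<le> g k"
    and f: "0 \<le> f 0" "\<And>n. card (offsets :: (int ^ 'n) set) * g n + (card (offsets :: (int ^ 'n) set) * f n)\<^sup>2 \<le> f (Suc n)"
  shows "prob {\<omega> \<in> space P. certificate (occupied C \<omega>) n z} \<le> f n"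
proof (induction n arbitrary: z)
  case 0
  then show ?case using f by simp
next
  case (Suc n)
  let ?E = "\<lambda>u. {\<omega> \<in> space P. certificate (occupied C \<omega>) n (refine z u)}"
  let ?H = "\<lambda>u. hit (C (n, refine z u))"
  let ?I = "{(u :: int ^ 'n, u') \<in> offsets \<times> offsets. \<exists>i. 24 < \<bar>u $ i - u' $ i\<bar>}"
  let ?N = "card (offsets :: (int ^ 'n) set)"
  have ev: "?E u \<in> events" for u
    using hit_sigma_sets_in_events[OF C certificate_event] .
  have evH: "?H u \<in> events" for u using hit_in_events[OF C] .
  have fin: "finite ?I" by (rule finite_subset[of _ "offsets \<times> offsets"]) (auto simp: finite_offsets)
  have f0: "0 \<le> f n" using Suc.IH[of z] measure_nonneg order_trans by blast
  have "card ?I \<le> card (offsets \<times> offsets :: ((int ^ 'n) \<times> (int ^ 'n)) set)"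
    by (rule card_mono) (auto simp: finite_offsets)
  then have card: "real (card ?I) \<le> real ?N * real ?N"
    unfolding card_cartesian_product by (simp flip: of_nat_mult)
  have "{\<omega> \<in> space P. certificate (occupied C \<omega>) (Suc n) z} = (\<Union>u\<in>offsets. ?H u) \<union> (\<Union>(u, u')\<in>?I. ?E u \<inter> ?E u')"
    unfolding certificate.simps occupied_def hit_def mem_Collect_eq by blast
  then have "prob {\<omega> \<in> space P. certificate (occupied C \<omega>) (Suc n) z} \<le>
      prob (\<Union>u\<in>offsets. ?H u) + prob (\<Union>(u, u')\<in>?I. ?E u \<inter> ?E u')"
    using ev evH fin finite_offsets by (simp only:) (intro measure_Un_le; auto)
  also have "prob (\<Union>u\<in>offsets. ?H u) \<le> (\<Sum>u\<in>offsets. prob (?H u))"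
    using evH finite_offsets by (intro finite_measure_subadditive_finite) auto
  also have "\<dots> \<le> (\<Sum>u\<in>(offsets :: (int ^ 'n) set). g n)" by (intro sum_mono g)
  also have "prob (\<Union>(u, u')\<in>?I. ?E u \<inter> ?E u') \<le> (\<Sum>w\<in>?I. prob (case w of (u, u') \<Rightarrow> ?E u \<inter> ?E u'))"
    using ev fin by (intro finite_measure_subadditive_finite) auto
  also have "\<dots> \<le> (\<Sum>w\<in>?I. f n * f n)"
  proof (rule sum_mono)
    fix w assume "w \<in> ?I"
    then obtain u u' i where w: "w = (u, u')" "24 < \<bar>u $ i - u' $ i\<bar>" by auto
    have "prob (?E u \<inter> ?E u') = prob (?E u) * prob (?E u')"
      using prob_Int_hit_sigma[OF disj C certificate_cells_disjoint[OF w(2)] certificate_event certificate_event] .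
    also have "\<dots> \<le> f n * f n" using f0 by (intro mult_mono Suc.IH) auto
    finally show "prob (case w of (u, u') \<Rightarrow> ?E u \<inter> ?E u') \<le> f n * f n" by (simp only: w prod.case)
  qed
  also have "\<dots> = card ?I * (f n * f n)" by simp
  also have "\<dots> \<le> (real ?N * real ?N) * (f n * f n)" using card f0 by (intro mult_right_mono) auto
  also have "(\<Sum>u\<in>(offsets :: (int ^ 'n) set). g n) + (real ?N * real ?N) * (f n * f n) = ?N * g n + (?N * f n)\<^sup>2"
    by (simp add: power2_eq_square)
  also have "\<dots> \<le> f (Suc n)" by (rule f)
  finally show ?case by simp
qed

end

subsection \<open>Sufficiency\<close>

lemma ennreal_term_le_suminf: "f i \<le> suminf (f :: nat \<Rightarrow> ennreal)"
  using sum_le_suminf[OF summableI, of "{i}" f] by simp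

lemma tail_conditionE:
  assumes lf: "locally_finite_pos \<mu>" and tail: "tail_condition d \<mu>"
  obtains K where "K \<ge> 0" "\<And>a. a > 0 \<Longrightarrow> a ^ d * measure \<mu> {a..<10 * a} \<le> K"
proof
  let ?S = "SUP r\<in>{0<..}. ennreal (r ^ d) * emeasure \<mu> {r..}"
  have fin: "?S < \<infinity>" using tail unfolding tail_condition_def .
  show "enn2real ?S \<ge> 0" by simp
  fix a :: real assume a: "a > 0"
  have "{a..} \<in> sets \<mu>" using a by (intro locally_finite_posD(4)[OF lf]) auto
  then have "emeasure \<mu> {a..<10 * a} \<le> emeasure \<mu> {a..}" by (rule emeasure_mono[rotated]) auto
  then have "ennreal (a ^ d) * emeasure \<mu> {a..<10 * a} \<le> ennreal (a ^ d) * emeasure \<mu> {a..}"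
    by (rule mult_left_mono) simp
  also have "\<dots> \<le> ?S" using a by (intro SUP_upper) auto
  finally have le: "ennreal (a ^ d * measure \<mu> {a..<10 * a}) \<le> ?S"
    using emeasure_eq_ennreal_measure[of \<mu> "{a..<10 * a}"] emeasure_shell_finite[OF lf a] a
    by (simp add: ennreal_mult)
  then show "a ^ d * measure \<mu> {a..<10 * a} \<le> enn2real ?S"
    using enn2real_mono[OF le fin[unfolded infinity_ennreal_def]] a by simp
qed

text \<open>A random variable \<open>R\<close> with \<open>R \<ge> q ^ n\<close> whenever
  \<open>M > 10 * d * 10 ^ n\<close> controls the moment. Its expectation is a series of crossing
  and large-ball probabilities that converges by (A3).\<close>

lemma radius_moment_finite:
  fixes \<xi> :: "'w \<Rightarrow> ((real ^ 'n) \<times> real) set" and s :: real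
  defines "q \<equiv> 10 powr s" and "N \<equiv> card (offsets :: (int ^ 'n) set)"
  assumes lf: "locally_finite_pos \<mu>" and s: "s > 0" and lam: "lam > 0"
    and mom: "moment_condition CARD('n) s \<mu>"
    and tail: "\<And>a. a > 0 \<Longrightarrow> a ^ CARD('n) * measure \<mu> {a..<10 * a} \<le> K"
    and small: "N * (lam * K) \<le> 1 / (4 * q * N\<^sup>2)"
    and ppp: "poisson_point_process P (boolean_intensity lam \<mu>) \<xi>"
  shows "radius_moment P \<xi> s < \<infinity>"
proof -
  interpret poisson_point_process P "boolean_intensity lam \<mu>" \<xi> by fact
  let ?d = "CARD('n)"
  have q: "q > 1" using s by (simp add: q_def)
  have N: "real N > 0" using card_offsets_pos by (simp add: N_def)
  define g where "g a = lam * (a ^ ?d * measure \<mu> {a..<10 * a})" for a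
  have g: "g a \<ge> 0" "N * g a \<le> 1 / (4 * q * N\<^sup>2)" if "a > 0" for a
  proof -
    show "g a \<ge> 0" using lam that by (simp add: g_def)
    have "N * g a \<le> N * (lam * K)"
      unfolding g_def using tail[OF that] lam N by (intro mult_left_mono) auto
    with small show "N * g a \<le> 1 / (4 * q * N\<^sup>2)" by linarith
  qed
  \<comment> \<open>For \<open>h \<le> \<tau>\<close> the quadratic term is linearised,
    \<open>(N * h)\<^sup>2 \<le> h / (2 * q)\<close>, while \<open>small\<close> reads
    \<open>N * (lam * K) \<le> \<tau> / 2\<close>; so \<open>\<tau>\<close> is stable under the
    recursion.\<close>
  define \<tau> where "\<tau> = 1 / (2 * q * N\<^sup>2)"
  have \<tau>: "\<tau> > 0" "N\<^sup>2 * \<tau> = 1 / (2 * q)" "1 / (4 * q * N\<^sup>2) = \<tau> / 2"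
    using q N by (auto simp: \<tau>_def)
  have half: "h / (2 * q) \<le> \<tau> / 2" if "h \<le> \<tau>" for h
  proof -
    have "h / (2 * q) \<le> \<tau> / (2 * q)" using that q by (intro divide_right_mono) auto
    also have "\<dots> \<le> \<tau> / (2 * 1)" using \<tau>(1) q by (intro divide_left_mono) auto
    finally show ?thesis by simp
  qed
  \<comment> \<open>\<open>H n\<close> bounds the certificates of size \<open>10 ^ n\<close>. The
    factor \<open>1 / (2 * q)\<close> makes \<open>q ^ n * H n\<close> contract by one half.\<close>
  define H where "H = rec_nat \<tau> (\<lambda>n h. N * g (10 ^ n) + h / (2 * q))"
  have H_Suc: "H (Suc n) = N * g (10 ^ n) + H n / (2 * q)" for n by (simp add: H_def)
  have H: "0 \<le> H n \<and> H n \<le> \<tau>" for n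
  proof (induction n)
    case 0
    then show ?case using \<tau> by (simp add: H_def)
  next
    case (Suc n)
    then show ?case using g[of "10 ^ n"] half[of "H n"] q unfolding H_Suc \<tau>(3) by auto
  qed
  define C :: "nat \<Rightarrow> nat \<times> (int ^ 'n) \<Rightarrow> ((real ^ 'n) \<times> real) set"
    where "C m = (\<lambda>(k, v). cell ((1 / 10) ^ m * 10 ^ k) v)" for m
  have cell: "cell a v \<in> sets (boolean_intensity lam \<mu>)" "prob (hit (cell a v)) \<le> g a" if "a > 0" for a and v :: "int ^ 'n"
    using prob_hit_le[OF measure_cell(1,2)[OF lf that lam, of v]] measure_cell(1,3)[OF lf that lam, of v]
    by (simp_all add: g_def)
  have C: "C m i \<in> sets (boolean_intensity lam \<mu>)" for m i by (simp add: C_def cell split: prod.split)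
  \<comment> \<open>With cut-off \<open>(1 / 10) ^ m\<close>, level \<open>n\<close> has size
    \<open>10 ^ (n - m)\<close>. For \<open>n \<le> m\<close> truncated subtraction yields
    \<open>H 0 = \<tau>\<close>, which is preserved by the recursion, so the bound at a fixed size
    is uniform in \<open>m\<close>.\<close>
  have cert: "prob {\<omega> \<in> space P. certificate (occupied (C m) \<omega>) n 0} \<le> H (n - m)" for m n
  proof (rule prob_certificate_le[where g = "\<lambda>k. g ((1 / 10) ^ m * 10 ^ k)" and f = "\<lambda>n. H (n - m)"])
    show "disjoint_family (C m)" unfolding C_def by (rule disjoint_family_cells) simp
    show "C m i \<in> sets (boolean_intensity lam \<mu>)" for i by (rule C)
    show "prob (hit (C m (k, v))) \<le> g ((1 / 10) ^ m * 10 ^ k)" for k v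
      unfolding C_def prod.case by (rule cell) simp
    show "0 \<le> H (0 - m)" using H by blast
    fix n
    let ?a = "(1 / 10) ^ m * 10 ^ n :: real"
    have "(N * H (n - m))\<^sup>2 \<le> H (n - m) / (2 * q)"
    proof -
      have "(N * H (n - m))\<^sup>2 = (N\<^sup>2 * H (n - m)) * H (n - m)" by (simp add: power2_eq_square mult_ac)
      also have "\<dots> \<le> (N\<^sup>2 * H (n - m)) * \<tau>"
        using H[of "n - m"] by (intro mult_left_mono) auto
      also have "\<dots> = (N\<^sup>2 * \<tau>) * H (n - m)" by simp
      finally show ?thesis unfolding \<tau>(2) by simp
    qed
    moreover have "N * g ?a + H (n - m) / (2 * q) \<le> H (Suc n - m)"
    proof (cases "m \<le> n")
      case True
      then have "?a = 10 ^ (n - m)" by (simp add: power_diff power_one_over)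
      then show ?thesis using True H_Suc[of "n - m"] by (simp add: Suc_diff_le)
    next
      case False
      then have "Suc n - m = 0" "n - m = 0" by auto
      then show ?thesis using g(2)[of ?a] half[of "H 0"] H[of 0] unfolding \<tau>(3) by (simp add: H_def)
    qed
    ultimately show "real (card (offsets :: (int ^ 'n) set)) * g ?a + (real (card (offsets :: (int ^ 'n) set)) * H (n - m))\<^sup>2 \<le> H (Suc n - m)"
      unfolding N_def by linarith
  qed
  \<comment> \<open>Certificates of size \<open>10 ^ n\<close> for all sufficiently fine cut-offs: a
    limit inferior, matching the random threshold of \<open>crossing_of_far_component\<close>.
    Continuity from below keeps the bound \<open>H n\<close>.\<close>
  define E where "E n = (\<Union>m0. \<Inter>m\<in>{m0..}. {\<omega> \<in> space P. certificate (occupied (C m) \<omega>) (m + n) 0})" for n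
  have ev: "{\<omega> \<in> space P. certificate (occupied (C m) \<omega>) n 0} \<in> events" for m n
    using hit_sigma_sets_in_events[OF C certificate_event] .
  have F_ev: "(\<Inter>m\<in>{m0..}. {\<omega> \<in> space P. certificate (occupied (C m) \<omega>) (m + n) 0}) \<in> events" for m0 n
    using ev by (intro sets.countable_INT') auto
  have E_ev: "E n \<in> events" for n unfolding E_def using F_ev by auto
  have E_le: "prob (E n) \<le> H n" for n
  proof -
    let ?F = "\<lambda>m0. \<Inter>m\<in>{m0..}. {\<omega> \<in> space P. certificate (occupied (C m) \<omega>) (m + n) 0}"
    have "(\<lambda>m0. prob (?F m0)) \<longlonglongrightarrow> prob (\<Union>m0. ?F m0)"
      using F_ev by (intro finite_Lim_measure_incseq) (auto simp: incseq_def)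
    moreover have "prob (?F m0) \<le> H n" for m0
    proof -
      have "prob (?F m0) \<le> prob {\<omega> \<in> space P. certificate (occupied (C m0) \<omega>) (m0 + n) 0}"
        using ev by (intro finite_measure_mono) auto
      also have "\<dots> \<le> H n" using cert[of m0 "m0 + n"] by simp
      finally show ?thesis .
    qed
    ultimately show ?thesis unfolding E_def by (intro LIMSEQ_le_const2) auto
  qed
  \<comment> \<open>The first series pays for crossings of size \<open>10 ^ n\<close>, the second
    for balls of radius about \<open>10 ^ j\<close> centred near the origin.\<close>
  define R where "R \<omega> = (\<Sum>n. ennreal (q ^ n) * indicator (E n) \<omega>) +
    (\<Sum>j. \<Sum>v\<in>(offsets :: (int ^ 'n) set). ennreal (q ^ j) * indicator (hit (cell (10 ^ j) v)) \<omega>)" for \<omega>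
  have R: "ennreal (q ^ n) \<le> R \<omega>"
    if \<omega>: "\<omega> \<in> space P" and far: "ennreal (10 * real ?d * 10 ^ n) < component_radius (\<xi> \<omega>)" for n \<omega>
  proof -
    have pos: "snd p > 0" if "p \<in> \<xi> \<omega>" for p
      using points_in_space[OF \<omega>] that unfolding space_boolean_intensity[OF lf] by auto
    obtain x where x: "x \<in> origin_component (\<xi> \<omega>)" "10 * ?d * 10 ^ n < norm x"
      using far unfolding component_radius_def less_SUP_iff by (auto simp: ennreal_less_iff)
    have "?d * (10 * 10 ^ n) < norm x" using x(2) by (simp add: mult_ac)
    also note norm_le_card_infnorm[of x]
    finally have far': "10 * 10 ^ n \<le> infnorm x" by simp
    show ?thesis
    \<comment> \<open>A large ball near the origin falls into a shell \<open>j \<ge> n\<close>, with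
      centre within \<open>100 * 10 ^ j\<close>, so one of the offset cells is hit. Its absence is
      the assumption \<open>small\<close> of \<open>crossing_of_far_component\<close> for
      \<open>A = 10 ^ n\<close>.\<close>
    proof (cases "\<exists>p\<in>\<xi> \<omega>. 10 ^ n \<le> snd p \<and> infnorm (fst p) \<le> 10 * snd p")
      case True
      then obtain p where p: "p \<in> \<xi> \<omega>" "10 ^ n \<le> snd p" "infnorm (fst p) \<le> 10 * snd p" by blast
      have "1 \<le> (10::real) ^ n" by simp
      then have "1 \<le> snd p" using p(2) by linarith
      then obtain j where j: "10 ^ j \<le> snd p" "snd p < 10 * 10 ^ j" using ex_decimal_shell by force
      have "(10::real) ^ n < 10 ^ Suc j" using p(2) j(2) by simp
      then have "n \<le> j" by (simp add: power_less_imp_less_exp less_Suc_eq_le[symmetric] del: power_Suc)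
      have "infnorm (fst p - lattice_point (10 * 10 ^ j) 0) \<le> 100 * 10 ^ j"
      proof -
        have "lattice_point (10 * 10 ^ j) 0 = (0 :: real ^ 'n)" by (simp add: lattice_point_def vec_eq_iff)
        then show ?thesis using p(3) j(2) by simp
      qed
      then obtain u where u: "u \<in> offsets" "fst p \<in> cube (10 ^ j) u"
        using ex_offset_cube[of "10 ^ j" "fst p" 0] by auto
      have hit: "\<omega> \<in> hit (cell (10 ^ j) u)"
        using p(1) j u(2) \<omega> by (cases p) (auto simp: hit_def cell_def)
      have "ennreal (q ^ n) \<le> ennreal (q ^ j)" using q \<open>n \<le> j\<close> by (intro ennreal_leI power_increasing) auto
      also have "\<dots> = ennreal (q ^ j) * indicator (hit (cell (10 ^ j) u)) \<omega>" using hit by simp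
      also have "\<dots> \<le> (\<Sum>v\<in>(offsets :: (int ^ 'n) set). ennreal (q ^ j) * indicator (hit (cell (10 ^ j) v)) \<omega>)"
        using u(1) finite_offsets by (intro member_le_sum) auto
      also have "\<dots> \<le> (\<Sum>j. \<Sum>v\<in>(offsets :: (int ^ 'n) set). ennreal (q ^ j) * indicator (hit (cell (10 ^ j) v)) \<omega>)"
        by (rule ennreal_term_le_suminf)
      also have "\<dots> \<le> R \<omega>" unfolding R_def by (intro add_increasing) auto
      finally show ?thesis .
    next
      case False
      then obtain \<delta>0 where \<delta>0: "\<delta>0 > 0"
        "\<And>\<delta> k. 0 < \<delta> \<Longrightarrow> \<delta> \<le> \<delta>0 \<Longrightarrow> \<delta> * 10 ^ k = 10 ^ n \<Longrightarrow> crossing (\<xi> \<omega>) \<delta> k 0"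
        using crossing_of_far_component[OF x(1) far' _ pos] by (force simp: not_le)
      obtain m0 where m0: "(1 / 10 :: real) ^ m0 < \<delta>0" using real_arch_pow_inv[OF \<delta>0(1)] by force
      have "certificate (occupied (C m) \<omega>) (m + n) 0" if "m \<ge> m0" for m
      proof -
        have "(1 / 10 :: real) ^ m \<le> (1 / 10) ^ m0" using that by (intro power_decreasing) auto
        then have "crossing (\<xi> \<omega>) ((1 / 10) ^ m) (m + n) 0"
          using m0 by (intro \<delta>0(2)) (auto simp: power_add power_one_over)
        then have "certificate {(k, v). \<xi> \<omega> \<inter> cell ((1 / 10) ^ m * 10 ^ k) v \<noteq> {}} (m + n) 0"
          by (rule crossing_imp_certificate[rotated]) simp
        also have "{(k, v). \<xi> \<omega> \<inter> cell ((1 / 10) ^ m * 10 ^ k) v \<noteq> {}} = occupied (C m) \<omega>"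
          by (auto simp: occupied_def C_def)
        finally show ?thesis .
      qed
      then have "\<omega> \<in> E n" using \<omega> by (auto simp: E_def)
      then have "ennreal (q ^ n) = ennreal (q ^ n) * indicator (E n) \<omega>" by simp
      also have "\<dots> \<le> (\<Sum>n. ennreal (q ^ n) * indicator (E n) \<omega>)"
        by (rule ennreal_term_le_suminf)
      also have "\<dots> \<le> R \<omega>" unfolding R_def by (intro add_increasing2) auto
      finally show ?thesis .
    qed
  qed
  have sg: "summable (\<lambda>k. q ^ k * g (10 ^ k))"
  proof -
    have "summable (\<lambda>k. lam * (q ^ k * ((10 ^ k) ^ ?d * measure \<mu> {10 ^ k..<10 * 10 ^ k})))"
      using mom unfolding moment_condition_iff_summable[OF lf s] q_def by (rule summable_mult)
    then show ?thesis by (simp add: g_def mult_ac)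
  qed
  \<comment> \<open>After multiplication by \<open>q ^ Suc n\<close> the factor
    \<open>1 / (2 * q)\<close> in \<open>H_Suc\<close> becomes \<open>1 / 2\<close>.\<close>
  have sH: "summable (\<lambda>n. q ^ n * H n)"
  proof (rule summable_half_recursion)
    show "summable (\<lambda>n. q * N * (q ^ n * g (10 ^ n)))" using sg by (rule summable_mult)
    show "0 \<le> q * N * (q ^ n * g (10 ^ n))" for n using q g(1)[of "10 ^ n"] by simp
    show "0 \<le> q ^ n * H n" for n using q H[of n] by simp
    show "q ^ Suc n * H (Suc n) \<le> q * N * (q ^ n * g (10 ^ n)) + q ^ n * H n / 2" for n
      unfolding H_Suc using q by (simp add: field_simps)
  qed
  have "(\<integral>\<^sup>+ \<omega>. R \<omega> \<partial>P) = (\<Sum>n. ennreal (q ^ n) * emeasure P (E n)) +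
      (\<Sum>j. \<Sum>v\<in>(offsets :: (int ^ 'n) set). ennreal (q ^ j) * emeasure P (hit (cell (10 ^ j) v)))"
    unfolding R_def using E_ev hit_in_events[OF cell(1)]
    by (simp add: nn_integral_add nn_integral_suminf nn_integral_sum nn_integral_cmult_indicator)
  also have "\<dots> \<le> (\<Sum>n. ennreal (q ^ n * H n)) + (\<Sum>j. ennreal (N * (q ^ j * g (10 ^ j))))"
  proof (intro add_mono suminf_le summableI)
    fix n
    show "ennreal (q ^ n) * emeasure P (E n) \<le> ennreal (q ^ n * H n)"
      using E_le[of n] q by (simp add: emeasure_eq_measure ennreal_mult[symmetric] ennreal_leI mult_left_mono)
    have "(\<Sum>v\<in>(offsets :: (int ^ 'n) set). ennreal (q ^ n) * emeasure P (hit (cell (10 ^ n) v))) \<le>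
        (\<Sum>v\<in>(offsets :: (int ^ 'n) set). ennreal (q ^ n * g (10 ^ n)))"
      using cell(2)[of "10 ^ n"] q
      by (intro sum_mono) (simp add: emeasure_eq_measure ennreal_mult[symmetric] ennreal_leI mult_left_mono)
    also have "\<dots> = ennreal (N * (q ^ n * g (10 ^ n)))"
      using q g(1)[of "10 ^ n"] by (simp add: N_def ennreal_mult ennreal_of_nat_eq_real_of_nat)
    finally show "(\<Sum>v\<in>(offsets :: (int ^ 'n) set). ennreal (q ^ n) * emeasure P (hit (cell (10 ^ n) v))) \<le>
        ennreal (N * (q ^ n * g (10 ^ n)))" .
  qed
  also have "\<dots> < \<infinity>"
  proof -
    have "(\<Sum>n. ennreal (q ^ n * H n)) \<noteq> top" "(\<Sum>j. ennreal (N * (q ^ j * g (10 ^ j)))) \<noteq> top"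
      using sH summable_mult[OF sg, of "real N"] q H g(1) by (intro ennreal_suminf_neq_top; simp)+
    then show ?thesis by (simp add: less_top)
  qed
  finally have R_fin: "(\<integral>\<^sup>+ \<omega>. R \<omega> \<partial>P) < \<infinity>" .
  have R_meas: "R \<in> borel_measurable P"
    unfolding R_def using E_ev hit_in_events[OF cell(1)] by (auto intro!: borel_measurable_add borel_measurable_suminf borel_measurable_sum)
  let ?c = "ennreal ((100 * (10 * real ?d)) powr s)"
  have "radius_moment P \<xi> s \<le> (\<integral>\<^sup>+ \<omega>. ?c * (1 + R \<omega>) \<partial>P)"
    unfolding radius_moment_def
    by (intro nn_integral_mono ennreal_powr_le s) (use R in \<open>simp_all add: q_def\<close>)
  also have "\<dots> = ?c * (1 + (\<integral>\<^sup>+ \<omega>. R \<omega> \<partial>P))"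
    using R_meas by (simp add: nn_integral_cmult nn_integral_add emeasure_space_1)
  also have "\<dots> < \<infinity>" using R_fin by (simp add: ennreal_mult_less_top less_top)
  finally show ?thesis .
qed

theorem theorem1p2:
  fixes \<mu> :: "real measure" and s :: real
    and P :: "real \<Rightarrow> 'w measure"
    and \<xi> :: "real \<Rightarrow> 'w \<Rightarrow> ((real ^ 'n) \<times> real) set"
  assumes "locally_finite_pos \<mu>"
    and "s > 0"
    and "\<And>lam. lam > 0 \<Longrightarrow> poisson_point_process (P lam) (boolean_intensity lam \<mu>) (\<xi> lam)"
  shows "(CARD('n) \<ge> 2 \<longrightarrow>
            ((\<exists>lam\<^sub>0>0. \<forall>lam\<in>{0<..<lam\<^sub>0}. radius_moment (P lam) (\<xi> lam) s < \<infinity>) \<longleftrightarrow>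
              tail_condition CARD('n) \<mu> \<and> moment_condition CARD('n) s \<mu>)) \<and>
         (CARD('n) = 1 \<longrightarrow>
            (tail_condition CARD('n) \<mu> \<and> moment_condition CARD('n) s \<mu> \<longrightarrow>
              (\<exists>lam\<^sub>0>0. \<forall>lam\<in>{0<..<lam\<^sub>0}. radius_moment (P lam) (\<xi> lam) s < \<infinity>)) \<and>
            ((\<exists>lam\<^sub>0>0. \<forall>lam\<in>{0<..<lam\<^sub>0}. radius_moment (P lam) (\<xi> lam) s < \<infinity>) \<longrightarrow>
              moment_condition CARD('n) s \<mu>))"
proof -
  let ?fin = "\<lambda>lam. radius_moment (P lam) (\<xi> lam) s < \<infinity>"
  have nec: "moment_condition CARD('n) s \<mu> \<and> (CARD('n) \<ge> 2 \<longrightarrow> tail_condition CARD('n) \<mu>)"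
    if ex: "\<exists>lam\<^sub>0>0. \<forall>lam\<in>{0<..<lam\<^sub>0}. ?fin lam"
  proof -
    obtain lam0 where "lam0 > 0" "\<forall>lam\<in>{0<..<lam0}. ?fin lam" using ex by blast
    \<comment> \<open>Necessity uses a single intensity; the midpoint of the interval
      serves.\<close>
    then have half: "lam0 / 2 > 0" "?fin (lam0 / 2)" by auto
    show ?thesis
      using moment_condition_necessary[OF assms(1,2) half(1) assms(3)[OF half(1)] half(2)]
        tail_condition_necessary[OF assms(1,2) half(1) _ assms(3)[OF half(1)] half(2)] by blast
  qed
  have suf: "\<exists>lam\<^sub>0>0. \<forall>lam\<in>{0<..<lam\<^sub>0}. ?fin lam"
    if tail: "tail_condition CARD('n) \<mu>" and mom: "moment_condition CARD('n) s \<mu>"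
  proof -
    obtain K where K: "K \<ge> 0" "\<And>a. a > 0 \<Longrightarrow> a ^ CARD('n) * measure \<mu> {a..<10 * a} \<le> K"
      using tail_conditionE[OF assms(1) tail] by blast
    let ?N = "card (offsets :: (int ^ 'n) set)"
    \<comment> \<open>The smallness hypothesis of \<open>radius_moment_finite\<close> solved for
      \<open>lam\<close>, with \<open>K + 1\<close> in place of \<open>K\<close> to avoid dividing
      by 0.\<close>
    let ?lam0 = "1 / (4 * (10 powr s) * ?N\<^sup>2) / (?N * (K + 1))"
    have N: "real ?N > 0" using card_offsets_pos by simp
    have NK: "?N * (K + 1) > 0" using N K(1) by simp
    have "?fin lam" if lam: "lam \<in> {0<..<?lam0}" for lam
    proof (rule radius_moment_finite[OF assms(1,2) _ mom K(2) _ assms(3)])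
      have "?N * (lam * K) \<le> lam * (?N * (K + 1))" using lam N by (simp add: algebra_simps)
      also have "\<dots> \<le> 1 / (4 * (10 powr s) * ?N\<^sup>2)"
        using lam NK unfolding greaterThanLessThan_iff by (simp only: pos_less_divide_eq less_imp_le)
      finally show "?N * (lam * K) \<le> 1 / (4 * (10 powr s) * ?N\<^sup>2)" .
    qed (use lam in auto)
    moreover have "?lam0 > 0" using N K(1) by simp
    ultimately show ?thesis by blast
  qed
  show ?thesis using nec suf by blast
qed

end
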